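(* Let $n$ be a positive even integer. If $z\in I_n^{\mathsf{FPF}}$ then $$\mathcal{FD}(z)=\{E\subseteq L_n^{\ne}:\hat D^{\mathsf{FPF}}_{\mathrm{bot}}(z)\le_{\mathcal{FD}}E\}=\{E\subseteq L_n^{\ne}:\hat D^{\mathsf{FPF}}_{\mathrm{bot}}(z)\sim_{\mathcal{FD}}E\},$$ where $L_n^{\ne}=\{(j,i)\in[n]\times[n]:i<j\}$.
   Context: $[n]=\{1,\dots,n\}$, $S_n$ is the symmetric group; $I_n^{\mathsf{FPF}}$ is the set of $z\in S_n$ with $z=z^{-1}$ and $z(i)\ne i$ for all $i\in[n]$. **Fpf-involution pipe dreams.** Positions $(i,j)$ are in matrix coordinates. For $D\subseteq\{(i,j)\in[n]\times[n]:i+j\le n\}$ the wiring diagram of $D$ is drawn as follows: in a cell $(i,j)\in D$ one path joins the left edge to the right edge and another joins the bottom edge to the top edge (they cross); in a cell $(i,j)\notin D$ with $i+j\le n$ one path joins left to top and another joins bottom to right; in a cell with $i+j=n+1$ a single path joins left to top. Connecting these gives $n$ pipes. $D$ is a reduced pipe dream if no two pipes cross more than once; it is a reduced pipe dream for $w\in S_n$ if, labeling left endpoints $1,\dots,n$ from top to bottom and top endpoints $1,\dots,n$ from left to right, the pipe with left endpoint $i$ has top endpoint $w(i)$ for each $i$. $\mathcal{PD}(w)$ is the set of these. $D$ is symmetric if $(i,j)\in D$ implies $(j,i)\in D$. $\mathcal{FD}(z)=\{D\cap L_n^{\ne}:D\in\mathcal{PD}(z)\text{ symmetric}\}$. **Bottom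 element.** For $z\in I_n^{\mathsf{FPF}}$ let $\hat c^{\mathsf{FPF}}_i(z)$ be the number of $j\in[n]$ with $j>i$, $z(i)>z(j)$ and $i>z(j)$. $\hat D^{\mathsf{FPF}}_{\mathrm{bot}}(z)=\{(i,j)\in[n]\times[n]:j\le\hat c^{\mathsf{FPF}}_i(z)\}$. **Ladder moves.** For subsets $D,E\subseteq\mathbb Z_{>0}\times\mathbb Z_{>0}$ write $D\lessdot_{\mathcal{PD}}E$ if for some integers $i<j$ and $k$: $\{i+1,\dots,j-1\}\times\{k,k+1\}\subset D$; $(j,k)\in D$ but $(i,k),(i,k+1),(j,k+1)\notin D$; and $E=D\setminus\{(j,k)\}\cup\{(i,k+1)\}$. Write $D\lessdot_{\mathcal{FD}}E$ if for some integers $0<i<j$ and $k\ge2$: $\{i+1,\dots,j-1\}\times\{k,k+1\}\subset D$; $(i,k),(j,k)\in D$ but $(i,k-1),(i,k+1),(i,k+2),(j,k+1)\notin D$; $E=D\setminus\{(j,k)\}\cup\{(i,k-1)\}$; and $D$ contains no positions strictly northeast of and in the same antidiagonal as $(i,k-2)$, $(i,k-1)$, $(i,k)$, $(i,k+1)$ or $(i,k+2)$. (An antidiagonal is a set of positions $(p,q)$ with $p+q$ constant. If $j=i+1$ the first condition is vacuous in both definitions.) Let $<_{\mathcal{FD}}$ be the transitive closure of the union of $\lessdot_{\mathcal{PD}}$ and $\lessdot_{\mathcal{FD}}$, let $\le_{\mathcal{FD}}$ be its reflexive version, and let $\sim_{\mathcal{FD}}$ be the symmetric closure of $\le_{\mathcal{FD}}$.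 *)

theory Defs
  imports "HOL-Combinatorics.Permutations"
begin

type_synonym pos = "nat \<times> nat"

text \<open>Fixed-point-free involutions in \<open>S\<^sub>n\<close>; permutations of \<open>[n]\<close> are functions on \<^typ>\<open>nat\<close>
  that fix everything outside \<open>{1..n}\<close>.\<close>

definition fpf_involutions :: "nat \<Rightarrow> (nat \<Rightarrow> nat) set" where
  "fpf_involutions n = {z. z permutes {1..n} \<and> z = inv z \<and> (\<forall>i\<in>{1..n}. z i \<noteq> i)}"

definition strict_lower :: "nat \<Rightarrow> pos set" where
  "strict_lower n = {(j, i). j \<in> {1..n} \<and> i \<in> {1..n} \<and> i < j}"

text \<open>Wiring diagrams.  An edge is addressed by the cell of which it is the left or the top edge, so
  the right edge of \<open>(i, j)\<close> is \<open>Left_edge i (j + 1)\<close> and its bottom edge is \<open>Top_edge (i + 1) j\<close>.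
  Every strand is oriented from the left or bottom edge of its cell to the top or right edge;
  traversed from their left endpoints, all pipes follow this orientation.\<close>

datatype edge = Left_edge nat nat | Top_edge nat nat

inductive strand :: "nat \<Rightarrow> pos set \<Rightarrow> edge \<Rightarrow> edge \<Rightarrow> bool" for n :: nat and D :: "pos set" where
  cross_lr: "1 \<le> i \<Longrightarrow> 1 \<le> j \<Longrightarrow> i + j \<le> n \<Longrightarrow> (i, j) \<in> D
    \<Longrightarrow> strand n D (Left_edge i j) (Left_edge i (j + 1))"
| cross_bt: "1 \<le> i \<Longrightarrow> 1 \<le> j \<Longrightarrow> i + j \<le> n \<Longrightarrow> (i, j) \<in> D
    \<Longrightarrow> strand n D (Top_edge (i + 1) j) (Top_edge i j)"
| bump_lt: "1 \<le> i \<Longrightarrow> 1 \<le> j \<Longrightarrow> i + j \<le> n \<Longrightarrow> (i, j) \<notin> D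
    \<Longrightarrow> strand n D (Left_edge i j) (Top_edge i j)"
| bump_br: "1 \<le> i \<Longrightarrow> 1 \<le> j \<Longrightarrow> i + j \<le> n \<Longrightarrow> (i, j) \<notin> D
    \<Longrightarrow> strand n D (Top_edge (i + 1) j) (Left_edge i (j + 1))"
| diag_lt: "1 \<le> i \<Longrightarrow> 1 \<le> j \<Longrightarrow> i + j = n + 1
    \<Longrightarrow> strand n D (Left_edge i j) (Top_edge i j)"

definition pipe :: "nat \<Rightarrow> pos set \<Rightarrow> nat \<Rightarrow> edge set" where
  "pipe n D p = {e. (strand n D)\<^sup>*\<^sup>* (Left_edge p 1) e}"

definition crossings :: "nat \<Rightarrow> pos set \<Rightarrow> nat \<Rightarrow> nat \<Rightarrow> pos set" where
  "crossings n D p q = {(i, j) \<in> D.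
     Left_edge i j \<in> pipe n D p \<and> Top_edge (i + 1) j \<in> pipe n D q \<or>
     Left_edge i j \<in> pipe n D q \<and> Top_edge (i + 1) j \<in> pipe n D p}"

definition reduced_pipe_dream :: "nat \<Rightarrow> pos set \<Rightarrow> bool" where
  "reduced_pipe_dream n D \<longleftrightarrow>
     D \<subseteq> {(i, j). i \<in> {1..n} \<and> j \<in> {1..n} \<and> i + j \<le> n} \<and>
     (\<forall>p\<in>{1..n}. \<forall>q\<in>{1..n}. p \<noteq> q \<longrightarrow> card (crossings n D p q) \<le> 1)"

definition PD :: "nat \<Rightarrow> (nat \<Rightarrow> nat) \<Rightarrow> pos set set" where
  "PD n w = {D. reduced_pipe_dream n D \<and> (\<forall>i\<in>{1..n}. Top_edge 1 (w i) \<in> pipe n D i)}"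

definition FD :: "nat \<Rightarrow> (nat \<Rightarrow> nat) \<Rightarrow> pos set set" where
  "FD n z = {D \<inter> strict_lower n | D. D \<in> PD n z \<and> sym D}"

definition fpf_code :: "nat \<Rightarrow> (nat \<Rightarrow> nat) \<Rightarrow> nat \<Rightarrow> nat" where
  "fpf_code n z i = card {j \<in> {1..n}. j > i \<and> z i > z j \<and> i > z j}"

definition fpf_bottom :: "nat \<Rightarrow> (nat \<Rightarrow> nat) \<Rightarrow> pos set" where
  "fpf_bottom n z = {(i, j). i \<in> {1..n} \<and> j \<in> {1..n} \<and> j \<le> fpf_code n z i}"

definition pos_quadrant :: "pos set" where
  "pos_quadrant = {(i, j). 1 \<le> i \<and> 1 \<le> j}"

definition northeast_antidiag :: "nat \<Rightarrow> nat \<Rightarrow> pos set" where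
  "northeast_antidiag i m = {(p, q) \<in> pos_quadrant. p < i \<and> m < q \<and> p + q = i + m}"

text \<open>Both moves relate subsets of \<^const>\<open>pos_quadrant\<close>.  For \<open>ladder_PD\<close> this forces
  \<open>1 \<le> i\<close> and \<open>1 \<le> k\<close>, since \<open>(i, k + 1) \<in> E\<close> and \<open>(j, k) \<in> D\<close>; hence letting the
  indices range over all integers instead would give the same relation.\<close>

definition ladder_PD :: "pos set \<Rightarrow> pos set \<Rightarrow> bool" where
  "ladder_PD D E \<longleftrightarrow> D \<subseteq> pos_quadrant \<and> E \<subseteq> pos_quadrant \<and>
     (\<exists>i j k. i < j \<and>
        {i+1..j-1} \<times> {k, k+1} \<subseteq> D \<and>
        (j, k) \<in> D \<and> (i, k) \<notin> D \<and> (i, k+1) \<notin> D \<and> (j, k+1) \<notin> D \<and>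
        E = (D - {(j, k)}) \<union> {(i, k+1)})"

definition ladder_FD :: "pos set \<Rightarrow> pos set \<Rightarrow> bool" where
  "ladder_FD D E \<longleftrightarrow> D \<subseteq> pos_quadrant \<and> E \<subseteq> pos_quadrant \<and>
     (\<exists>i j k. 0 < i \<and> i < j \<and> 2 \<le> k \<and>
        {i+1..j-1} \<times> {k, k+1} \<subseteq> D \<and>
        (i, k) \<in> D \<and> (j, k) \<in> D \<and>
        (i, k-1) \<notin> D \<and> (i, k+1) \<notin> D \<and> (i, k+2) \<notin> D \<and> (j, k+1) \<notin> D \<and>
        E = (D - {(j, k)}) \<union> {(i, k-1)} \<and>
        (\<forall>m\<in>{k-2, k-1, k, k+1, k+2}. D \<inter> northeast_antidiag i m = {}))"

definition less_FD :: "pos set \<Rightarrow> pos set \<Rightarrow> bool" where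
  "less_FD = (\<lambda>D E. ladder_PD D E \<or> ladder_FD D E)\<^sup>+\<^sup>+"

definition le_FD :: "pos set \<Rightarrow> pos set \<Rightarrow> bool" where
  "le_FD = less_FD\<^sup>=\<^sup>="

text \<open>The symmetric closure alone, not the generated equivalence relation.\<close>

definition sim_FD :: "pos set \<Rightarrow> pos set \<Rightarrow> bool" where
  "sim_FD = symclp le_FD"

end

theory Submission
  imports Defs
begin

text \<open>A set \<open>E\<close> below the diagonal has a reading word and hence a permutation \<open>W\<close>; the symmetric
  set \<open>E \<union> E\<inverse>\<close> together with the diagonal then has the permutation \<open>W \<theta> W\<^sup>-\<^sup>1\<close> with
  \<open>\<theta> = (1 2)(3 4)\<dots>\<close>, since the diagonal cells carry the letters \<open>1, 3, 5, \<dots>\<close>. A pipe dream is reduced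
  iff its number of crossings equals the number of inversions of its permutation, so \<open>E\<close> lies in
  \<open>FD n z\<close> iff \<open>z = W \<theta> W\<^sup>-\<^sup>1\<close> and \<open>z\<close> has \<open>2 |E| + n / 2\<close> inversions, the largest number possible for
  the given \<open>|E|\<close>.

  Braid and commutation relations show that a ladder move of the first kind preserves \<open>W\<close>, while one
  of the second kind multiplies \<open>W\<close> in a way that \<open>\<theta>\<close> absorbs; the second kind needs the letter
  \<open>i + k - 1\<close> to be even, and otherwise that letter could be deleted, contradicting the inversion count.
  Conversely, if some row of \<open>E\<close> is not left-justified, an inverse move of the first kind applies. If
  \<open>E\<close> is left-justified, its row lengths are a Lehmer code, by which \<open>W\<close> arranges the label pairs
  \<open>{2m - 1, 2m}\<close> on the cycles of \<open>z\<close>. Either the pairs appear in the order of the smaller elements of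
  the cycles, and \<open>E\<close> is the bottom element, or the first pair out of order gives an inverse move of
  the second kind.\<close>

section \<open>Inversions and reading words\<close>

abbreviation adj :: "nat \<Rightarrow> nat \<Rightarrow> nat" where
  "adj a \<equiv> transpose a (Suc a)"

lemma adj_permutes: "1 \<le> a \<Longrightarrow> a < n \<Longrightarrow> adj a permutes {1..n}"
  by (rule permutes_swap_id) auto

lemma adj_commute: "a + 2 \<le> b \<or> b + 2 \<le> a \<Longrightarrow> adj a \<circ> adj b = adj b \<circ> adj a"
  by (auto simp: fun_eq_iff transpose_def)

lemma adj_braid: "adj (Suc a) \<circ> adj a \<circ> adj (Suc a) = adj a \<circ> adj (Suc a) \<circ> adj a"
  by (auto simp: fun_eq_iff transpose_def)

definition inversions :: "nat \<Rightarrow> (nat \<Rightarrow> nat) \<Rightarrow> (nat \<times> nat) set" where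
  "inversions n f = {(p, q). 1 \<le> p \<and> p < q \<and> q \<le> n \<and> f q < f p}"

lemma finite_inversions [simp]: "finite (inversions n f)"
  by (rule finite_subset[of _ "{1..n} \<times> {1..n}"]) (auto simp: inversions_def)

text \<open>An inversion of \<open>f \<circ> g\<close> that \<open>g\<close> does not invert is
  carried by \<open>g\<close>, applied to both entries, to an inversion of \<open>f\<close>, and
  this map is injective.\<close>

lemma card_inversions_comp:
  assumes g: "g permutes {1..n}"
  shows "card (inversions n (f \<circ> g)) \<le> card (inversions n f) + card (inversions n g)"
proof -
  have gin: "1 \<le> g x \<and> g x \<le> n" if "1 \<le> x" "x \<le> n" for x
    using permutes_in_image[OF g, of x] that by auto
  have inj: "g x = g y \<longleftrightarrow> x = y" for x y
    using permutes_inj[OF g] by (auto dest: injD)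
  let ?N = "inversions n (f \<circ> g) - inversions n g"
  have "card ?N \<le> card (inversions n f)"
  proof (rule card_inj_on_le)
    show "inj_on (map_prod g g) ?N"
      by (auto simp: inj_on_def inj)
    show "map_prod g g ` ?N \<subseteq> inversions n f"
      using gin inj by (force simp: inversions_def not_less order_less_le)
  qed auto
  moreover have "card (inversions n (f \<circ> g)) \<le> card (?N \<union> inversions n g)"
    by (rule card_mono) auto
  ultimately show ?thesis
    using card_Un_le[of ?N "inversions n g"] by linarith
qed

lemma inversions_adj: "1 \<le> a \<Longrightarrow> a < n \<Longrightarrow> inversions n (adj a) = {(a, Suc a)}"
  by (auto simp: inversions_def transpose_def split: if_splits)

lemma card_inversions_inv:
  assumes f: "f permutes {1..n}"
  shows "card (inversions n (inv f)) = card (inversions n f)"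
proof -
  have fin: "1 \<le> f x \<and> f x \<le> n" if "1 \<le> x" "x \<le> n" for x
    using permutes_in_image[OF f, of x] that by auto
  have iin: "1 \<le> inv f x \<and> inv f x \<le> n" if "1 \<le> x" "x \<le> n" for x
    using permutes_in_image[OF permutes_inv[OF f], of x] that by auto
  have "bij_betw (\<lambda>(p, q). (f q, f p)) (inversions n f) (inversions n (inv f))"
    by (rule bij_betw_byWitness[where f' = "\<lambda>(p, q). (inv f q, inv f p)"])
      (use fin iin in \<open>auto simp: inversions_def permutes_inverses[OF f]\<close>)
  then show ?thesis
    by (simp add: bij_betw_same_card)
qed

text \<open>Applying \<open>adj a\<close> to both entries carries the inversions of the product
  injectively into those of \<open>f\<close>, and the descent \<open>(a, Suc a)\<close> is never
  hit.\<close>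

lemma card_inversions_comp_adj_less:
  assumes a: "1 \<le> a" "a < n" and desc: "f (Suc a) < f a"
  shows "card (inversions n (f \<circ> adj a)) < card (inversions n f)"
proof -
  have "card (inversions n (f \<circ> adj a)) \<le> card (inversions n f - {(a, Suc a)})"
  proof (rule card_inj_on_le)
    show "inj_on (map_prod (adj a) (adj a)) (inversions n (f \<circ> adj a))"
      by (intro map_prod_inj_on[THEN inj_on_subset, of _ UNIV _ UNIV] inj_transpose) auto
    show "map_prod (adj a) (adj a) ` inversions n (f \<circ> adj a) \<subseteq> inversions n f - {(a, Suc a)}"
      using a desc by (auto simp: inversions_def transpose_def split: if_splits)
  qed auto
  also have "\<dots> < card (inversions n f)"
    by (rule card_Diff1_less[OF finite_inversions]) (use a desc in \<open>simp_all add: inversions_def\<close>)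
  finally show ?thesis .
qed

text \<open>The \<theta> of the overview: for even \<open>n\<close>, the product of the
  transpositions of \<open>2 m - 1\<close> and \<open>2 m\<close> with
  \<open>2 m \<le> n\<close>.\<close>

definition theta :: "nat \<Rightarrow> nat \<Rightarrow> nat" where
  "theta n x = (if 1 \<le> x \<and> x \<le> n then if odd x then x + 1 else x - 1 else x)"

lemma theta_theta: "even n \<Longrightarrow> theta n (theta n x) = x"
  by (cases "odd x") (auto simp: theta_def less_eq_Suc_le[symmetric] dest: le_neq_implies_less)

lemma theta_in: "even n \<Longrightarrow> 1 \<le> x \<Longrightarrow> x \<le> n \<Longrightarrow> 1 \<le> theta n x \<and> theta n x \<le> n"
  by (cases "odd x") (auto simp: theta_def elim: oddE evenE dest: le_neq_implies_less)

lemma theta_permutes: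
  assumes "even n"
  shows "theta n permutes {1..n}"
proof (rule bij_imp_permutes)
  show "bij_betw (theta n) {1..n} {1..n}"
    using assms theta_theta[OF assms]
    by (intro bij_betw_byWitness[where f' = "theta n"]) (auto dest: theta_in)
qed (auto simp: theta_def)

lemma card_inversions_theta: "card (inversions n (theta n)) \<le> n div 2"
proof -
  have "inversions n (theta n) \<subseteq> (\<lambda>m. (2 * m + 1, 2 * m + 2)) ` {..<n div 2}"
  proof (clarify, goal_cases)
    case (1 p q)
    then have "odd p" "q = p + 1" "q \<le> n"
      by (auto simp: inversions_def theta_def split: if_splits elim!: oddE evenE)
    then show ?case
      by (intro image_eqI[of _ _ "p div 2"]) (auto elim!: oddE)
  qed
  then show ?thesis
    using surj_card_le[of "{..<n div 2}"] by simp
qed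

text \<open>Conjugation by \<open>V\<close> costs at most the length of \<open>V\<close> on each
  side, and \<theta> has at most \<open>n div 2\<close> inversions. The sets sought attain this
  bound, which drives the minimality arguments below.\<close>

lemma card_inversions_conj_le:
  assumes n: "even n" and V: "V permutes {1..n}" and zV: "z \<circ> V = V \<circ> theta n"
  shows "card (inversions n z) \<le> 2 * card (inversions n V) + n div 2"
proof -
  have z: "z = V \<circ> (theta n \<circ> inv V)"
    using zV by (metis comp_assoc comp_id permutes_inv_o(1)[OF V])
  have "card (inversions n z) \<le> card (inversions n V) + card (inversions n (theta n \<circ> inv V))"
    unfolding z by (intro card_inversions_comp permutes_compose permutes_inv V theta_permutes n)
  moreover have "card (inversions n (theta n \<circ> inv V)) \<le> n div 2 + card (inversions n V)"
    using card_inversions_comp[OF permutes_inv[OF V], of "theta n"] card_inversions_theta[of n]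
    by (simp add: card_inversions_inv[OF V])
  ultimately show ?thesis
    by simp
qed

section \<open>Words in adjacent transpositions and the reading word of a set of cells\<close>

definition word_perm :: "nat list \<Rightarrow> nat \<Rightarrow> nat" where
  "word_perm ws = foldr (\<lambda>a f. adj a \<circ> f) ws id"

lemma word_perm_Nil [simp]: "word_perm [] = id"
  and word_perm_Cons [simp]: "word_perm (a # ws) = adj a \<circ> word_perm ws"
  by (simp_all add: word_perm_def)

lemma word_perm_append [simp]: "word_perm (us @ vs) = word_perm us \<circ> word_perm vs"
  by (induction us) (auto simp: comp_assoc)

lemma word_perm_permutes: "set ws \<subseteq> {1..<n} \<Longrightarrow> word_perm ws permutes {1..n}"
proof (induction ws)
  case (Cons a ws)
  then show ?case
    using adj_permutes[of a n] by (auto simp del: o_apply intro!: permutes_compose)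
qed (simp add: permutes_id)

lemma card_inversions_word_perm: "set ws \<subseteq> {1..<n} \<Longrightarrow> card (inversions n (word_perm ws)) \<le> length ws"
proof (induction ws)
  case Nil
  have "inversions n id = {}"
    by (auto simp: inversions_def)
  then show ?case by (simp add: id_def)
next
  case (Cons a ws)
  then have "card (inversions n (word_perm (a # ws))) \<le> card (inversions n (adj a)) + card (inversions n (word_perm ws))"
    unfolding word_perm_Cons by (intro card_inversions_comp word_perm_permutes) auto
  with Cons show ?case
    by (simp add: inversions_adj del: word_perm_Cons)
qed

lemma adj_word_perm_commute:
  assumes "\<forall>b\<in>set ws. a + 2 \<le> b \<or> b + 2 \<le> a"
  shows "adj a \<circ> word_perm ws = word_perm ws \<circ> adj a"
  using assms
proof (induction ws)
  case (Cons b ws)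
  have "adj a \<circ> word_perm (b # ws) = adj b \<circ> (adj a \<circ> word_perm ws)"
    using adj_commute[of a b] Cons.prems by (simp add: fun_eq_iff)
  also have "\<dots> = word_perm (b # ws) \<circ> adj a"
    using Cons by (simp add: comp_assoc del: o_apply)
  finally show ?case .
qed simp

text \<open>A cell \<open>(i, j)\<close> carries the letter \<open>i + j - 1\<close>; the cells are read from the bottom row to
  the top row, and from left to right within a row.\<close>

definition col_word :: "pos set \<Rightarrow> nat \<Rightarrow> nat \<Rightarrow> nat \<Rightarrow> nat list" where
  "col_word E i l m = map (\<lambda>j. i + j - 1) (filter (\<lambda>j. (i, j) \<in> E) [l..<m])"

definition rows_word :: "nat \<Rightarrow> pos set \<Rightarrow> nat \<Rightarrow> nat \<Rightarrow> nat list" where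
  "rows_word n E l m = concat (map (\<lambda>i. col_word E i 1 (Suc n)) (rev [l..<m]))"

abbreviation rows_perm :: "nat \<Rightarrow> pos set \<Rightarrow> nat \<Rightarrow> nat \<Rightarrow> nat \<Rightarrow> nat" where
  "rows_perm n E l m \<equiv> word_perm (rows_word n E l m)"

text \<open>The \<open>W\<close> of the overview: the product along the whole reading word, the
  letter read first being applied last.\<close>

abbreviation dream_perm :: "nat \<Rightarrow> pos set \<Rightarrow> nat \<Rightarrow> nat" where
  "dream_perm n E \<equiv> rows_perm n E 1 (Suc n)"

lemma set_col_word: "set (col_word E i l m) = {i + j - 1 | j. l \<le> j \<and> j < m \<and> (i, j) \<in> E}"
  by (auto simp: col_word_def)

lemma set_rows_word:
  "set (rows_word n E l m) = {i + j - 1 | i j. l \<le> i \<and> i < m \<and> 1 \<le> j \<and> j \<le> n \<and> (i, j) \<in> E}"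
  by (fastforce simp: rows_word_def set_col_word less_Suc_eq_le)

lemma col_word_cong:
  "(\<And>j. l \<le> j \<Longrightarrow> j < m \<Longrightarrow> (i, j) \<in> D \<longleftrightarrow> (i, j) \<in> E) \<Longrightarrow> col_word D i l m = col_word E i l m"
  by (auto simp: col_word_def intro!: arg_cong[of _ _ "map _"] filter_cong)

lemma rows_word_cong:
  "(\<And>i j. l \<le> i \<Longrightarrow> i < m \<Longrightarrow> (i, j) \<in> D \<longleftrightarrow> (i, j) \<in> E) \<Longrightarrow> rows_word n D l m = rows_word n E l m"
  by (auto simp: rows_word_def intro!: arg_cong[of _ _ concat] col_word_cong)

lemma col_word_split:
  "l \<le> k \<Longrightarrow> k < m \<Longrightarrow>
    col_word E i l m = col_word E i l k @ (if (i, k) \<in> E then [i + k - 1] else []) @ col_word E i (Suc k) m"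
  using upt_add_eq_append[of l k "m - k"] by (simp add: col_word_def upt_conv_Cons)

lemma rows_word_split:
  "l \<le> k \<Longrightarrow> k \<le> m \<Longrightarrow> rows_word n E l m = rows_word n E k m @ rows_word n E l k"
  using upt_add_eq_append[of l k "m - k"] by (simp add: rows_word_def)

lemma rows_word_Suc: "l \<le> i \<Longrightarrow> rows_word n E l (Suc i) = col_word E i 1 (Suc n) @ rows_word n E l i"
  by (simp add: rows_word_def)

lemma rows_word_empty [simp]: "rows_word n E l l = []"
  by (simp add: rows_word_def)

lemma length_rows_word:
  assumes "E \<subseteq> strict_lower n"
  shows "length (rows_word n E 1 (Suc n)) = card E"
proof -
  let ?C = "\<lambda>i. {j \<in> {1..<Suc n}. (i, j) \<in> E}"
  have len: "length (col_word E i 1 (Suc n)) = card (?C i)" for i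
    using distinct_card[of "filter (\<lambda>j. (i, j) \<in> E) [1..<Suc n]"]
    by (simp add: col_word_def conj_commute del: upt_Suc)
  have "E = Sigma {1..n} ?C"
    using assms by (auto simp: strict_lower_def)
  then have "card E = (\<Sum>i\<in>{1..n}. card (?C i))"
    using card_SigmaI[of "{1..n}" ?C] by simp
  also have "{1..n} = set [1..<Suc n]"
    by auto
  also have "(\<Sum>i\<in>set [1..<Suc n]. card (?C i)) = sum_list (map (\<lambda>i. card (?C i)) [1..<Suc n])"
    by (simp add: sum_list_distinct_conv_sum_set del: upt_Suc)
  also have "\<dots> = length (rows_word n E 1 (Suc n))"
    by (simp add: rows_word_def length_concat len rev_map[symmetric] sum_list_rev comp_def len[simplified] del: upt_Suc)
  finally show ?thesis by simp
qed

section \<open>Pushing letters through rows\<close>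

lemma adj_comp_adj [simp]: "adj a \<circ> adj a = id" "adj a \<circ> (adj a \<circ> f) = f"
  by (auto simp: fun_eq_iff)

lemma comp_swap:
  assumes "f \<circ> g = g \<circ> f'"
  shows "f \<circ> (g \<circ> h) = g \<circ> (f' \<circ> h)"
  using arg_cong[OF assms, of "\<lambda>u. u \<circ> h"] unfolding comp_assoc .

lemma dream_perm_split:
  assumes "1 \<le> i" "i \<le> n"
  shows "dream_perm n E = rows_perm n E (Suc i) (Suc n) \<circ> rows_perm n E 1 (Suc i)"
  using assms rows_word_split[of 1 "Suc i" "Suc n" n E] by simp

text \<open>The letter \<open>r + k\<close> commutes with the cells left of column \<open>k\<close>,
  meets the consecutive letters \<open>r + k - 1\<close>, \<open>r + k\<close>, leaves them by the
  braid relation as \<open>r + k - 1\<close>, and commutes with the cells from column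
  \<open>k + 2\<close> on.\<close>

lemma push_row:
  assumes r: "1 \<le> r" "1 \<le> k" "k < n" and E: "(r, k) \<in> E" "(r, Suc k) \<in> E"
  shows "adj (r + k) \<circ> word_perm (col_word E r 1 (Suc n)) =
    word_perm (col_word E r 1 (Suc n)) \<circ> adj (r + k - 1)"
proof -
  let ?A = "col_word E r 1 k" and ?B = "col_word E r (Suc (Suc k)) (Suc n)"
  have w: "col_word E r 1 (Suc n) = ?A @ [r + k - 1, r + k] @ ?B"
    using assms col_word_split[of 1 k "Suc n" E r] col_word_split[of "Suc k" "Suc k" "Suc n" E r]
    by (simp add: col_word_def)
  have A: "adj (r + k) \<circ> word_perm ?A = word_perm ?A \<circ> adj (r + k)"
    by (rule adj_word_perm_commute) (use r in \<open>auto simp: set_col_word\<close>)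
  have B: "adj (r + k - 1) \<circ> word_perm ?B = word_perm ?B \<circ> adj (r + k - 1)"
    by (rule adj_word_perm_commute) (use r in \<open>auto simp: set_col_word\<close>)
  have braid: "adj (r + k) \<circ> (adj (r + k - 1) \<circ> (adj (r + k) \<circ> f)) = adj (r + k - 1) \<circ> (adj (r + k) \<circ> (adj (r + k - 1) \<circ> f))"
    for f :: "nat \<Rightarrow> nat"
    using adj_braid[of "r + k - 1"] r by (simp add: comp_assoc[symmetric] del: o_apply)
  show ?thesis
    unfolding w word_perm_append word_perm_Cons word_perm_Nil comp_id
    by (simp only: comp_assoc comp_swap[OF A] B[symmetric] braid)
qed

text \<open>Iterates \<open>push_row\<close> from row \<open>m - 1\<close> up to row
  \<open>l\<close>; each row crossed lowers the letter by one.\<close>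

lemma push_rows:
  assumes "l \<le> m" "1 \<le> l" "1 \<le> k" "k < n" "\<And>r. l \<le> r \<Longrightarrow> r < m \<Longrightarrow> (r, k) \<in> E \<and> (r, Suc k) \<in> E"
  shows "adj (m + k - 1) \<circ> rows_perm n E l m = rows_perm n E l m \<circ> adj (l + k - 1)"
  using assms(1,5)
proof (induction m rule: dec_induct)
  case (step m)
  have "adj (Suc m + k - 1) \<circ> rows_perm n E l (Suc m)
      = adj (m + k) \<circ> word_perm (col_word E m 1 (Suc n)) \<circ> rows_perm n E l m"
    using step by (simp add: rows_word_Suc comp_assoc)
  also have "adj (m + k) \<circ> word_perm (col_word E m 1 (Suc n)) =
      word_perm (col_word E m 1 (Suc n)) \<circ> adj (m + k - 1)"
    using step assms(2-4) by (intro push_row) auto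
  also have "\<dots> \<circ> rows_perm n E l m = rows_perm n E l (Suc m) \<circ> adj (l + k - 1)"
    using step by (simp add: rows_word_Suc comp_assoc del: o_apply)
  finally show ?case .
qed simp

text \<open>Since \<open>(j, k + 1)\<close> is missing, the letter of \<open>(j, k)\<close> commutes
  with the rest of its row. It then climbs the rows between \<open>j\<close> and \<open>i\<close>
  and arrives as the letter \<open>i + k\<close> just before row \<open>i\<close>.\<close>

lemma dream_perm_lift:
  assumes ij: "1 \<le> i" "i < j" "j \<le> n" and k: "1 \<le> k" "k < n"
    and mid: "{i + 1..j - 1} \<times> {k, k + 1} \<subseteq> E" and E: "(j, k) \<in> E" "(j, k + 1) \<notin> E"
  defines "X \<equiv> E - {(j, k)}"
  shows "dream_perm n E = rows_perm n X (Suc i) (Suc n) \<circ> adj (i + k) \<circ> rows_perm n X 1 (Suc i)"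
proof -
  let ?A = "word_perm (col_word X j 1 k)" and ?B = "word_perm (col_word X j (Suc k) (Suc n))"
    and ?P = "rows_perm n X (Suc i) j" and ?U = "rows_perm n X (Suc j) (Suc n)"
    and ?L = "rows_perm n X 1 (Suc i)"
  have same: "rows_word n E (Suc j) (Suc n) = rows_word n X (Suc j) (Suc n)"
    "rows_word n E (Suc i) j = rows_word n X (Suc i) j"
    "rows_word n E 1 (Suc i) = rows_word n X 1 (Suc i)"
    by (intro rows_word_cong; use ij in \<open>auto simp: X_def\<close>)+
  have colE: "word_perm (col_word E j 1 (Suc n)) = ?A \<circ> adj (j + k - 1) \<circ> ?B"
    and colX: "word_perm (col_word X j 1 (Suc n)) = ?A \<circ> ?B"
    using k E col_word_split[of 1 k "Suc n" E j] col_word_split[of 1 k "Suc n" X j]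
      col_word_cong[of 1 k j E X] col_word_cong[of "Suc k" "Suc n" j E X]
    by (simp_all add: X_def comp_assoc)
  have rows: "rows_word n Y (Suc i) (Suc n) = rows_word n Y (Suc j) (Suc n) @ col_word Y j 1 (Suc n) @ rows_word n Y (Suc i) j" for Y
    using ij rows_word_split[of "Suc i" "Suc j" "Suc n" n Y] by (simp add: rows_word_Suc)
  have B: "adj (j + k - 1) \<circ> ?B = ?B \<circ> adj (j + k - 1)"
  proof (rule adj_word_perm_commute, rule ballI)
    fix b assume "b \<in> set (col_word X j (Suc k) (Suc n))"
    then obtain q where q: "b = j + q - 1" "Suc k \<le> q" "(j, q) \<in> E"
      by (auto simp: set_col_word X_def)
    then have "q \<noteq> Suc k"
      using E by auto
    with q show "j + k - 1 + 2 \<le> b \<or> b + 2 \<le> j + k - 1"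
      using ij by linarith
  qed
  have P: "adj (j + k - 1) \<circ> ?P = ?P \<circ> adj (i + k)"
  proof -
    have "adj (j + k - 1) \<circ> ?P = ?P \<circ> adj (Suc i + k - 1)"
    proof (rule push_rows)
      fix r assume "Suc i \<le> r" "r < j"
      then have "{(r, k), (r, Suc k)} \<subseteq> {i + 1..j - 1} \<times> {k, k + 1}"
        by auto
      with mid \<open>r < j\<close> show "(r, k) \<in> X \<and> (r, Suc k) \<in> X"
        unfolding X_def by blast
    qed (use ij k in auto)
    then show ?thesis
      by (simp del: o_apply)
  qed
  have "dream_perm n E = ?U \<circ> (?A \<circ> adj (j + k - 1) \<circ> ?B) \<circ> ?P \<circ> ?L"
    using ij by (simp only: dream_perm_split[of i n E] rows same colE word_perm_append comp_assoc)
  also have "\<dots> = ?U \<circ> (?A \<circ> ?B) \<circ> ?P \<circ> adj (i + k) \<circ> ?L"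
    by (simp only: comp_assoc comp_swap[OF B] comp_swap[OF P])
  also have "\<dots> = rows_perm n X (Suc i) (Suc n) \<circ> adj (i + k) \<circ> ?L"
    by (simp only: rows colX word_perm_append comp_assoc)
  finally show ?thesis .
qed

text \<open>The letter of \<open>(i, k + 1)\<close> is \<open>i + k\<close>; with
  \<open>(i, k)\<close> missing it commutes with everything to its left in the row. This is how a
  lifted letter becomes a cell again.\<close>

lemma rows_perm_insert:
  assumes i: "1 \<le> i" "1 \<le> k" "k < n" and X: "(i, k) \<notin> X" "(i, Suc k) \<notin> X"
  shows "rows_perm n (insert (i, Suc k) X) 1 (Suc i) = adj (i + k) \<circ> rows_perm n X 1 (Suc i)"
proof -
  let ?Y = "insert (i, Suc k) X"
  let ?A = "word_perm (col_word X i 1 k)" and ?B = "word_perm (col_word X i (Suc (Suc k)) (Suc n))"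
  have A: "adj (i + k) \<circ> ?A = ?A \<circ> adj (i + k)"
    by (rule adj_word_perm_commute) (use i in \<open>auto simp: set_col_word\<close>)
  have cX: "word_perm (col_word X i 1 (Suc n)) = ?A \<circ> ?B"
    using i X col_word_split[of 1 k "Suc n" X i] col_word_split[of "Suc k" "Suc k" "Suc n" X i]
    by (simp add: col_word_def)
  have cY: "word_perm (col_word ?Y i 1 (Suc n)) = ?A \<circ> adj (i + k) \<circ> ?B"
    using i X col_word_split[of 1 k "Suc n" ?Y i] col_word_split[of "Suc k" "Suc k" "Suc n" ?Y i]
      col_word_cong[of 1 k i X ?Y] col_word_cong[of "Suc (Suc k)" "Suc n" i X ?Y]
    by (simp add: comp_assoc) (simp add: col_word_def)
  have "rows_word n ?Y 1 i = rows_word n X 1 i"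
    by (rule rows_word_cong) auto
  then show ?thesis
    using i by (simp only: rows_word_Suc word_perm_append cX cY A comp_assoc[symmetric])
qed

lemma rows_perm_insert_above:
  "rows_perm n (insert (i, k) X) (Suc i) (Suc n) = rows_perm n X (Suc i) (Suc n)"
  by (rule arg_cong[of _ _ word_perm], rule rows_word_cong) auto

lemma dream_perm_insert:
  assumes "1 \<le> i" "i \<le> n" "1 \<le> k" "k < n" "(i, k) \<notin> X" "(i, Suc k) \<notin> X"
  shows "dream_perm n (insert (i, Suc k) X) =
    rows_perm n X (Suc i) (Suc n) \<circ> adj (i + k) \<circ> rows_perm n X 1 (Suc i)"
  unfolding dream_perm_split[OF assms(1,2)] rows_perm_insert_above
    rows_perm_insert[OF assms(1,3,4,5,6)] comp_assoc ..

section \<open>Conjugates of \<theta> by short words, and the criterion for membership\<close>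

text \<open>On the points from \<open>a - 1\<close> to \<open>a + 2\<close>, conjugation by
  \<open>adj a\<close> turns \<theta> into the involution pairing \<open>a - 1\<close> with
  \<open>a + 1\<close> and \<open>a\<close> with \<open>a + 2\<close>. Exchanging
  \<open>a - 1\<close> with \<open>a\<close> and \<open>a + 1\<close> with \<open>a + 2\<close>
  merely swaps these two cycles.\<close>

lemma theta_block_commute:
  assumes a: "even a" "2 \<le> a" "a + 2 \<le> n" and n: "even n"
  shows "(adj (a + 1) \<circ> adj (a - 1)) \<circ> (adj a \<circ> theta n \<circ> adj a) =
    (adj a \<circ> theta n \<circ> adj a) \<circ> (adj (a + 1) \<circ> adj (a - 1))"
proof
  fix x
  obtain b where b: "a = b + 1" "odd b"
    using a by (metis add.commute add_diff_inverse_nat even_plus_one_iff gr_implies_not0 less_one nat_neq_iff not_numeral_le_zero)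
  have th: "theta n b = b + 1" "theta n (b + 1) = b" "theta n (b + 2) = b + 3" "theta n (b + 3) = b + 2"
    using a b by (auto simp: theta_def)
  show "((adj (a + 1) \<circ> adj (a - 1)) \<circ> (adj a \<circ> theta n \<circ> adj a)) x =
    ((adj a \<circ> theta n \<circ> adj a) \<circ> (adj (a + 1) \<circ> adj (a - 1))) x"
  proof (cases "x \<in> {b, b + 1, b + 2, b + 3}")
    case True
    then show ?thesis
      using th by (auto simp: b transpose_def numeral_eq_Suc)
  next
    case False
    \<comment> \<open>\<theta> preserves the block, hence also its complement, where the
      transpositions act trivially.\<close>
    then have "theta n x \<notin> {b, b + 1, b + 2, b + 3}"
      using theta_theta[OF n, of x] th by auto
    with False show ?thesis
      by (simp add: b transpose_def)
  qed
qed

text \<open>Turns a right factor of the intertwiner into a conjugation of \<open>t\<close>; in this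
  way \<theta> absorbs letters at the end of a reading word.\<close>

lemma intertwine_comp:
  fixes z :: "'a \<Rightarrow> 'a"
  assumes "x' \<circ> x = id" "x \<circ> x' = id"
  shows "z \<circ> (M \<circ> x) = (M \<circ> x) \<circ> t \<longleftrightarrow> z \<circ> M = M \<circ> (x \<circ> t \<circ> x')"
proof
  assume "z \<circ> (M \<circ> x) = (M \<circ> x) \<circ> t"
  from arg_cong[OF this, of "\<lambda>u. u \<circ> x'"] show "z \<circ> M = M \<circ> (x \<circ> t \<circ> x')"
    by (simp only: comp_assoc assms comp_id)
next
  assume "z \<circ> M = M \<circ> (x \<circ> t \<circ> x')"
  from arg_cong[OF this, of "\<lambda>u. u \<circ> x"] show "z \<circ> (M \<circ> x) = (M \<circ> x) \<circ> t"
    by (simp only: comp_assoc assms comp_id)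
qed

text \<open>The criterion of the overview for membership in \<open>FD n z\<close>. Intertwining
  stands for the conjugation, so that no inverse occurs, and the last clause demands the largest
  inversion number that \<open>card E\<close> cells allow.\<close>

definition fpf_dream :: "nat \<Rightarrow> (nat \<Rightarrow> nat) \<Rightarrow> pos set \<Rightarrow> bool" where
  "fpf_dream n z E \<longleftrightarrow> E \<subseteq> strict_lower n \<and> (\<forall>(i, j)\<in>E. i + j \<le> n) \<and>
     z \<circ> dream_perm n E = dream_perm n E \<circ> theta n \<and>
     card (inversions n z) = 2 * card E + n div 2"

lemma finite_strict_lower [simp]: "finite (strict_lower n)"
  by (rule finite_subset[of _ "{1..n} \<times> {1..n}"]) (auto simp: strict_lower_def)

lemma set_dream_word:
  assumes "E \<subseteq> strict_lower n" "\<forall>(i, j)\<in>E. i + j \<le> n"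
  shows "set (rows_word n E 1 (Suc n)) \<subseteq> {1..<n}"
  using assms by (fastforce simp: set_rows_word strict_lower_def)

lemma dream_perm_permutes:
  assumes "E \<subseteq> strict_lower n" "\<forall>(i, j)\<in>E. i + j \<le> n"
  shows "dream_perm n E permutes {1..n}"
  by (intro word_perm_permutes set_dream_word assms)

text \<open>A smaller set with the intertwining property would leave \<open>z\<close> too few
  inversions. Configurations are excluded below by deleting cells without destroying that
  property.\<close>

lemma fpf_dream_minimal:
  assumes "even n" "fpf_dream n z E" "F \<subset> E"
  shows "z \<circ> dream_perm n F \<noteq> dream_perm n F \<circ> theta n"
proof
  assume zF: "z \<circ> dream_perm n F = dream_perm n F \<circ> theta n"
  have F: "F \<subseteq> strict_lower n" "\<forall>(i, j)\<in>F. i + j \<le> n"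
    using assms by (auto simp: fpf_dream_def)
  have "card (inversions n z) \<le> 2 * card (inversions n (dream_perm n F)) + n div 2"
    by (intro card_inversions_conj_le assms zF dream_perm_permutes F)
  also have "card (inversions n (dream_perm n F)) \<le> card F"
    using card_inversions_word_perm[OF set_dream_word[OF F]] length_rows_word[OF F(1)] by simp
  also have "card F < card E"
    using assms(2,3) by (intro psubset_card_mono) (auto simp: fpf_dream_def intro: finite_subset)
  finally show False
    using assms(2) by (simp add: fpf_dream_def)
qed

section \<open>Ladder moves\<close>

text \<open>Let \<open>X\<close> be the common part. Lifting \<open>(j, k)\<close> in
  \<open>D\<close> and inserting \<open>(i, k + 1)\<close> to form \<open>E\<close> both amount to
  placing the letter \<open>i + k\<close> before row \<open>i\<close> of \<open>X\<close>, so the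
  permutations agree.\<close>

lemma ladder_PD_fpf_dream_iff:
  assumes n: "even n" and D: "D \<subseteq> strict_lower n" and E: "E \<subseteq> strict_lower n"
    and ladder: "ladder_PD D E"
  shows "fpf_dream n z D \<longleftrightarrow> fpf_dream n z E"
proof -
  obtain i j k where ij: "i < j" and mid: "{i + 1..j - 1} \<times> {k, k + 1} \<subseteq> D"
    and jk: "(j, k) \<in> D" "(j, k + 1) \<notin> D" and ik: "(i, k) \<notin> D" "(i, k + 1) \<notin> D"
    and E_eq: "E = D - {(j, k)} \<union> {(i, k + 1)}"
    using ladder unfolding ladder_PD_def by blast
  define X where "X = D - {(j, k)}"
  have E_ins: "E = insert (i, Suc k) X" and D_ins: "D = insert (j, k) X"
    using E_eq jk by (auto simp: X_def)
  have bounds: "1 \<le> i" "1 \<le> k" "k < n" "i \<le> n" "j \<le> n"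
    using D E jk E_ins by (auto simp: strict_lower_def)
  have X: "(i, k) \<notin> X" "(i, Suc k) \<notin> X" "(j, k) \<notin> X"
    using ik by (auto simp: X_def)
  have "dream_perm n D = rows_perm n X (Suc i) (Suc n) \<circ> adj (i + k) \<circ> rows_perm n X 1 (Suc i)"
    unfolding X_def by (rule dream_perm_lift[of i j n k D]) (use bounds ij mid jk in auto)
  also have "\<dots> = dream_perm n E"
    unfolding E_ins by (rule dream_perm_insert[symmetric]) (use bounds X in auto)
  finally have perm: "dream_perm n D = dream_perm n E" .
  have "finite X"
    using D by (auto simp: X_def intro: finite_subset)
  then have card: "card D = card E"
    using X by (simp add: E_ins D_ins)
  \<comment> \<open>The antidiagonal of \<open>(j, k)\<close> contains a cell of \<open>E\<close>:
    \<open>(i, k + 1)\<close> if \<open>j = Suc i\<close>, and \<open>(j - 1, k + 1)\<close>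
    otherwise.\<close>
  have "j + k \<le> n" if "\<forall>(p, q)\<in>E. p + q \<le> n"
  proof (cases "j = Suc i")
    case True
    then show ?thesis
      using that by (auto simp: E_ins)
  next
    case False
    then have "(j - 1, k + 1) \<in> D"
      using ij by (intro subsetD[OF mid]) auto
    then have "(j - 1, k + 1) \<in> E"
      using ij by (auto simp: E_eq)
    then show ?thesis
      using that ij by fastforce
  qed
  then have "(\<forall>(p, q)\<in>D. p + q \<le> n) \<longleftrightarrow> (\<forall>(p, q)\<in>E. p + q \<le> n)"
    using ij by (auto simp: D_ins E_ins)
  then show ?thesis
    using D E perm card by (simp add: fpf_dream_def)
qed

text \<open>Row \<open>i\<close> is free around column \<open>k\<close> and the rows above have no
  cells on nearby antidiagonals, so the letters \<open>a - 1\<close>, \<open>a\<close>,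
  \<open>a + 1\<close> commute with everything read after them. They move to the right end of the
  word, next to \<theta>; the six cases record the resulting tails.\<close>

lemma clear_row_perms:
  assumes X: "X \<subseteq> strict_lower n" and ik: "1 \<le> i" "i \<le> n" "2 \<le> k" "k \<le> n"
    and row: "(i, k - 1) \<notin> X" "(i, k) \<notin> X" "(i, k + 1) \<notin> X" "(i, k + 2) \<notin> X"
    and clear: "\<And>p q. p < i \<Longrightarrow> (p, q) \<in> X \<Longrightarrow> p + q + 2 < i + k \<or> i + k + 2 < p + q"
  defines "a \<equiv> i + k - 1" and "U \<equiv> rows_perm n X (Suc i) (Suc n)" and "M \<equiv> dream_perm n X"
  shows "dream_perm n (insert (i, k - 1) X) = M \<circ> adj (a - 1)"
    and "dream_perm n (insert (i, k) X) = M \<circ> adj a"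
    and "dream_perm n (insert (i, k - 1) (insert (i, k) X)) = M \<circ> (adj (a - 1) \<circ> adj a)"
    and "U \<circ> adj (a + 1) \<circ> rows_perm n (insert (i, k) X) 1 (Suc i) = M \<circ> (adj (a + 1) \<circ> adj a)"
    and "U \<circ> adj (a + 1) \<circ> rows_perm n (insert (i, k - 1) (insert (i, k) X)) 1 (Suc i) =
      M \<circ> (adj (a + 1) \<circ> adj (a - 1) \<circ> adj a)"
    and "U \<circ> adj (a + 1) \<circ> rows_perm n X 1 (Suc i) = M \<circ> adj (a + 1)"
proof -
  \<comment> \<open>The part of the word after the two cells; \<open>A\<close> is the part of row
    \<open>i\<close> before them.\<close>
  define cw where "cw = col_word X i (Suc k) (Suc n) @ rows_word n X 1 i"
  define A where "A = word_perm (col_word X i 1 (k - 1))"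
  define C where "C = word_perm cw"
  have far: "c + 2 < a \<or> a + 2 < c" if c: "c \<in> set cw" for c
  proof -
    consider q where "c = i + q - 1" "k + 1 \<le> q" "(i, q) \<in> X"
      | p q where "c = p + q - 1" "1 \<le> p" "p < i" "(p, q) \<in> X"
      using c by (auto simp: cw_def set_col_word set_rows_word)
    then show ?thesis
    proof cases
      case 1
      then have "q \<noteq> k + 1" "q \<noteq> k + 2"
        using row by metis+
      then show ?thesis
        using 1 ik unfolding a_def by arith
    next
      case 2
      then show ?thesis
        using clear[of p q] ik by (auto simp: a_def)
    qed
  qed
  have C: "adj b \<circ> C = C \<circ> adj b" if "b \<in> {a - 1, a, a + 1}" for b
    unfolding C_def by (rule adj_word_perm_commute) (use that far in fastforce)
  have A: "adj (a + 1) \<circ> A = A \<circ> adj (a + 1)"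
    unfolding A_def by (rule adj_word_perm_commute) (use ik in \<open>auto simp: set_col_word a_def\<close>)
  have row_perm: "rows_perm n Y 1 (Suc i) = A \<circ> ((if (i, k - 1) \<in> Y then adj (a - 1) else id) \<circ>
      ((if (i, k) \<in> Y then adj a else id) \<circ> C))"
    if Y: "Y - {(i, k - 1), (i, k)} = X" for Y
  proof -
    have same: "col_word Y i 1 (k - 1) = col_word X i 1 (k - 1)"
      "col_word Y i (Suc k) (Suc n) = col_word X i (Suc k) (Suc n)"
      "rows_word n Y 1 i = rows_word n X 1 i"
      by (intro col_word_cong rows_word_cong; use Y in auto)+
    have "col_word Y i 1 (Suc n) = col_word Y i 1 (k - 1) @
        ((if (i, k - 1) \<in> Y then [i + (k - 1) - 1] else []) @
        ((if (i, k) \<in> Y then [i + k - 1] else []) @ col_word Y i (Suc k) (Suc n)))"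
      using ik col_word_split[of 1 "k - 1" "Suc n" Y i] col_word_split[of k k "Suc n" Y i]
      by (simp add: col_word_def del: upt_Suc)
    moreover have "i + (k - 1) - 1 = a - 1" "i + k - 1 = a"
      using ik by (auto simp: a_def)
    ultimately show ?thesis
      using ik by (simp add: rows_word_Suc same[unfolded One_nat_def] A_def C_def cw_def comp_assoc del: o_apply)
  qed
  have dream: "dream_perm n Y = U \<circ> rows_perm n Y 1 (Suc i)" if "Y - {(i, k - 1), (i, k)} = X" for Y
  proof -
    have "rows_word n Y (Suc i) (Suc n) = rows_word n X (Suc i) (Suc n)"
      by (rule rows_word_cong) (use that in auto)
    then show ?thesis
      unfolding dream_perm_split[OF ik(1,2)] U_def by (simp only:)
  qed
  have km: "k - 1 \<noteq> k"
    using ik by simp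
  have Xs: "X - {(i, k - 1), (i, k)} = X" "insert (i, k - 1) X - {(i, k - 1), (i, k)} = X"
    "insert (i, k) X - {(i, k - 1), (i, k)} = X"
    "insert (i, k - 1) (insert (i, k) X) - {(i, k - 1), (i, k)} = X"
    using row by auto
  have M: "M = U \<circ> (A \<circ> C)"
    using dream[OF Xs(1)] row_perm[OF Xs(1)] row by (simp add: M_def del: o_apply)
  have C': "C \<circ> (adj b \<circ> f) = adj b \<circ> (C \<circ> f)" "C \<circ> adj b = adj b \<circ> C" if "b \<in> {a - 1, a, a + 1}" for b and f :: "nat \<Rightarrow> nat"
    using comp_swap[OF C[OF that], of f] C[OF that] by (simp_all only:)
  show "dream_perm n (insert (i, k - 1) X) = M \<circ> adj (a - 1)"
    unfolding dream[OF Xs(2)] row_perm[OF Xs(2)] M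
    using row km by (simp add: comp_assoc C' del: o_apply)
  show "dream_perm n (insert (i, k) X) = M \<circ> adj a"
    unfolding dream[OF Xs(3)] row_perm[OF Xs(3)] M
    using row km by (simp add: comp_assoc C' del: o_apply)
  show "dream_perm n (insert (i, k - 1) (insert (i, k) X)) = M \<circ> (adj (a - 1) \<circ> adj a)"
    unfolding dream[OF Xs(4)] row_perm[OF Xs(4)] M
    using row km by (simp add: comp_assoc C' del: o_apply)
  show "U \<circ> adj (a + 1) \<circ> rows_perm n (insert (i, k) X) 1 (Suc i) = M \<circ> (adj (a + 1) \<circ> adj a)"
    unfolding row_perm[OF Xs(3)] M
    using row km by (simp add: comp_assoc C' comp_swap[OF A[simplified]] del: o_apply)
  show "U \<circ> adj (a + 1) \<circ> rows_perm n (insert (i, k - 1) (insert (i, k) X)) 1 (Suc i) =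
      M \<circ> (adj (a + 1) \<circ> adj (a - 1) \<circ> adj a)"
    unfolding row_perm[OF Xs(4)] M
    using row km by (simp add: comp_assoc C' comp_swap[OF A[simplified]] del: o_apply)
  show "U \<circ> adj (a + 1) \<circ> rows_perm n X 1 (Suc i) = M \<circ> adj (a + 1)"
    unfolding row_perm[OF Xs(1)] M
    using row km by (simp add: comp_assoc C' comp_swap[OF A[simplified]] del: o_apply)
qed

text \<open>For odd \<open>a\<close> the points \<open>a\<close> and \<open>Suc a\<close> form a
  cycle of \<theta>.\<close>

lemma theta_adj_odd:
  assumes "odd a" "a < n"
  shows "adj a \<circ> theta n \<circ> adj a = theta n"
proof
  fix x
  show "(adj a \<circ> theta n \<circ> adj a) x = theta n x"
  proof (cases "x = a \<or> x = Suc a")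
    case True
    then show ?thesis
      using assms odd_pos[OF assms(1)] by (auto simp: theta_def)
  next
    case False
    then have "theta n x \<noteq> a" "theta n x \<noteq> Suc a"
      using assms by (auto simp: theta_def split: if_splits) presburger+
    with False show ?thesis
      by (simp add: transpose_def)
  qed
qed

text \<open>Rearrangements of \<open>theta_block_commute\<close>: the first accounts for ladder
  moves of the second kind, the second allows two cells to be deleted at once.\<close>

lemma theta_block:
  assumes "even a" "2 \<le> a" "a + 2 \<le> n" "even n"
  shows "(adj (a + 1) \<circ> adj a) \<circ> theta n \<circ> (adj a \<circ> adj (a + 1)) =
    (adj (a - 1) \<circ> adj a) \<circ> theta n \<circ> (adj a \<circ> adj (a - 1))"
    and "(adj (a + 1) \<circ> adj (a - 1) \<circ> adj a) \<circ> theta n \<circ> (adj a \<circ> adj (a - 1) \<circ> adj (a + 1)) =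
      adj a \<circ> theta n \<circ> adj a"
proof -
  define t where "t = adj a \<circ> theta n \<circ> adj a"
  have comm: "adj (a + 1) \<circ> (adj (a - 1) \<circ> t) = t \<circ> (adj (a + 1) \<circ> adj (a - 1))"
    using theta_block_commute[OF assms] by (simp only: t_def comp_assoc)
  have "adj (a - 1) \<circ> t = adj (a + 1) \<circ> (t \<circ> (adj (a + 1) \<circ> adj (a - 1)))"
    by (simp only: comm[symmetric] adj_comp_adj)
  then have "(adj (a - 1) \<circ> t) \<circ> adj (a - 1) = adj (a + 1) \<circ> (t \<circ> (adj (a + 1) \<circ> adj (a - 1))) \<circ> adj (a - 1)"
    by (rule arg_cong)
  then have "adj (a - 1) \<circ> (t \<circ> adj (a - 1)) = adj (a + 1) \<circ> (t \<circ> adj (a + 1))"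
    by (simp only: comp_assoc adj_comp_adj comp_id)
  then show "(adj (a + 1) \<circ> adj a) \<circ> theta n \<circ> (adj a \<circ> adj (a + 1)) =
    (adj (a - 1) \<circ> adj a) \<circ> theta n \<circ> (adj a \<circ> adj (a - 1))"
    by (simp only: t_def comp_assoc)
  have "(adj (a + 1) \<circ> (adj (a - 1) \<circ> t)) \<circ> (adj (a - 1) \<circ> adj (a + 1)) = t"
    unfolding comm by (simp only: comp_assoc adj_comp_adj comp_id)
  then show "(adj (a + 1) \<circ> adj (a - 1) \<circ> adj a) \<circ> theta n \<circ> (adj a \<circ> adj (a - 1) \<circ> adj (a + 1)) =
      adj a \<circ> theta n \<circ> adj a"
    by (simp only: t_def comp_assoc)
qed

text \<open>With the letters moved to the right end, \<open>D\<close> ends in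
  \<open>a + 1, a\<close> and \<open>E\<close> in \<open>a - 1, a\<close>; for even \<open>a\<close>
  both tails conjugate \<theta> to the same involution. For odd \<open>a\<close> neither set
  satisfies the criterion, because \<theta> absorbs the final letter \<open>a\<close>.\<close>

lemma ladder_FD_fpf_dream_iff:
  assumes n: "even n" and D: "D \<subseteq> strict_lower n" and E: "E \<subseteq> strict_lower n"
    and ladder: "ladder_FD D E"
  shows "fpf_dream n z D \<longleftrightarrow> fpf_dream n z E"
proof -
  obtain i j k where ij: "0 < i" "i < j" and k: "2 \<le> k"
    and mid: "{i + 1..j - 1} \<times> {k, k + 1} \<subseteq> D"
    and ik: "(i, k) \<in> D" "(i, k - 1) \<notin> D" "(i, k + 1) \<notin> D" "(i, k + 2) \<notin> D"
    and jk: "(j, k) \<in> D" "(j, k + 1) \<notin> D"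
    and E_eq: "E = D - {(j, k)} \<union> {(i, k - 1)}"
    and ne: "\<forall>m\<in>{k - 2, k - 1, k, k + 1, k + 2}. D \<inter> northeast_antidiag i m = {}"
    using ladder unfolding ladder_FD_def by blast
  define X where "X = D - {(j, k), (i, k)}"
  define a where "a = i + k - 1"
  define M where "M = dream_perm n X"
  have E_ins: "E = insert (i, k - 1) (insert (i, k) X)" and D_ins: "D = insert (j, k) (insert (i, k) X)"
    and DX: "D - {(j, k)} = insert (i, k) X"
    using E_eq jk ij ik by (auto simp: X_def)
  have bounds: "i \<le> n" "j \<le> n" "k < n" "k \<le> n"
    using D ik jk by (auto simp: strict_lower_def)
  have X: "X \<subseteq> strict_lower n" "(i, k - 1) \<notin> X" "(i, k) \<notin> X" "(i, k + 1) \<notin> X" "(i, k + 2) \<notin> X"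
    "(j, k) \<notin> X"
    using ik D by (auto simp: X_def)
  have clear: "p + q + 2 < i + k \<or> i + k + 2 < p + q" if pq: "p < i" "(p, q) \<in> X" for p q
  proof (rule ccontr)
    assume "\<not> ?thesis"
    then have "p + q - i \<in> {k - 2, k - 1, k, k + 1, k + 2}" "i \<le> p + q"
      using k ij by auto
    moreover have "(p, q) \<in> northeast_antidiag i (p + q - i)"
      using pq X(1) \<open>i \<le> p + q\<close> by (auto simp: northeast_antidiag_def pos_quadrant_def strict_lower_def)
    ultimately show False
      using ne pq by (auto simp: X_def)
  qed
  have "1 \<le> i"
    using ij by simp
  note row = clear_row_perms[OF X(1) \<open>1 \<le> i\<close> bounds(1) k bounds(4) X(2-5) clear, folded a_def M_def]
  have a1: "i + k = a + 1"
    using ij by (simp add: a_def)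
  \<comment> \<open>The case without \<open>(i, k)\<close> provides the smaller competitor of
    \<open>D\<close> when \<open>a\<close> is odd.\<close>
  have lift: "dream_perm n Y = rows_perm n (Y - {(j, k)}) (Suc i) (Suc n) \<circ> adj (a + 1) \<circ>
      rows_perm n (Y - {(j, k)}) 1 (Suc i)" if "Y = D \<or> Y = D - {(i, k)}" for Y
    unfolding a1[symmetric]
    by (rule dream_perm_lift[of i j n k Y]) (use that bounds ij k mid jk in auto)
  have permD: "dream_perm n D = M \<circ> (adj (a + 1) \<circ> adj a)"
    unfolding lift[OF disjI1[OF refl]] DX rows_perm_insert_above by (rule row(4))
  have permE: "dream_perm n E = M \<circ> (adj (a - 1) \<circ> adj a)"
    unfolding E_ins by (rule row(3))
  have "D - {(i, k)} - {(j, k)} = X"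
    by (auto simp: X_def)
  then have permD': "dream_perm n (D - {(i, k)}) = M \<circ> adj (a + 1)"
    using lift[of "D - {(i, k)}"] row(6) by (simp only: simp_thms)
  have "E - {(i, k)} = insert (i, k - 1) X"
    using k X by (auto simp: E_ins)
  then have permE': "dream_perm n (E - {(i, k)}) = M \<circ> adj (a - 1)"
    using row(1) by simp
  have "finite X"
    using X(1) by (rule finite_subset) simp
  then have card: "card D = card E"
    using X k ij by (simp add: D_ins E_ins card_insert_if)
  have even_a: "even a" if dream: "fpf_dream n z Y" and Y: "(i, k) \<in> Y" "dream_perm n Y = N \<circ> adj a"
    "dream_perm n (Y - {(i, k)}) = N" for Y N
  proof (rule ccontr)
    assume odd: "odd a"
    have an: "a < n"
      using dream Y(1) ij a1 by (auto simp: fpf_dream_def)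
    have "z \<circ> (N \<circ> adj a) = (N \<circ> adj a) \<circ> theta n"
      using dream Y(2) by (simp add: fpf_dream_def)
    then have "z \<circ> N = N \<circ> theta n"
      unfolding intertwine_comp[OF adj_comp_adj(1) adj_comp_adj(1)] theta_adj_odd[OF odd an] .
    moreover have "Y - {(i, k)} \<subset> Y"
      using Y(1) by auto
    ultimately show False
      using fpf_dream_minimal[OF n dream] Y(3) by metis
  qed
  have triD: "even a \<and> j + k \<le> n" if "fpf_dream n z D"
    using even_a[OF that ik(1) _ permD'] permD that jk by (auto simp: comp_assoc fpf_dream_def)
  have triE: "even a \<and> j + k \<le> n" if dream: "fpf_dream n z E"
  proof -
    have "even a"
    proof (rule even_a[OF dream _ _ permE'])
      show "dream_perm n E = M \<circ> adj (a - 1) \<circ> adj a"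
        by (simp only: permE comp_assoc)
    qed (simp add: E_ins)
    moreover have "i + k \<le> n"
      using dream by (auto simp: fpf_dream_def E_ins)
    \<comment> \<open>\<open>i + k\<close> is odd and \<open>n\<close> is even, so the bound
      \<open>i + k \<le> n\<close> improves by one; this settles \<open>j = Suc i\<close>.\<close>
    ultimately have "i + k + 1 \<le> n"
      using n a1 by (metis Suc_eq_plus1 even_Suc le_antisym not_less_eq_eq)
    moreover have "j + k \<le> n" if "j \<noteq> Suc i"
    proof -
      have "(j - 1, k + 1) \<in> D"
        using ij that by (intro subsetD[OF mid]) auto
      then have "(j - 1, k + 1) \<in> E"
        using ij by (auto simp: E_eq)
      then show ?thesis
        using dream ij by (fastforce simp: fpf_dream_def)
    qed
    ultimately show ?thesis
      using \<open>even a\<close> by (cases "j = Suc i") auto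
  qed
  have inverse: "(adj b \<circ> adj c) \<circ> (adj c \<circ> adj b) = id" for b c
    by (simp only: comp_assoc adj_comp_adj)
  have perm: "z \<circ> dream_perm n D = dream_perm n D \<circ> theta n \<longleftrightarrow>
      z \<circ> dream_perm n E = dream_perm n E \<circ> theta n" if "even a" "j + k \<le> n"
  proof -
    have a: "2 \<le> a" "a + 2 \<le> n"
      using that ij k a1 by auto
    show ?thesis
      unfolding permD permE intertwine_comp[OF inverse inverse] theta_block(1)[OF that(1) a n] ..
  qed
  have "(\<forall>(p, q)\<in>D. p + q \<le> n) \<longleftrightarrow> (\<forall>(p, q)\<in>E. p + q \<le> n)" if "j + k \<le> n"
    using that ij by (auto simp: D_ins E_ins)
  then show ?thesis
    using triD triE perm card D E unfolding fpf_dream_def by metis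
qed

section \<open>Inverse ladder moves and Lehmer codes\<close>

text \<open>Lifting \<open>(j, k)\<close> would put the letter \<open>i + k\<close> in front of row
  \<open>i\<close>, where it cancels the letter of \<open>(i, k + 1)\<close>; both cells could be
  deleted.\<close>

lemma fpf_dream_no_double_crossing:
  assumes n: "even n" and E: "fpf_dream n z E"
    and ij: "i < j" and mid: "{i + 1..j - 1} \<times> {k, k + 1} \<subseteq> E"
    and ik: "(i, k + 1) \<in> E" "(i, k) \<notin> E" and jk: "(j, k) \<in> E"
  shows "(j, k + 1) \<in> E"
proof (rule ccontr)
  assume nE: "(j, k + 1) \<notin> E"
  define X where "X = E - {(j, k)}"
  define Y where "Y = X - {(i, Suc k)}"
  have bounds: "1 \<le> i" "1 \<le> k" "k < n" "i \<le> n" "j \<le> n"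
    using E ik jk by (auto simp: fpf_dream_def strict_lower_def)
  have XY: "X = insert (i, Suc k) Y"
    using ik ij by (auto simp: X_def Y_def)
  have Y: "(i, k) \<notin> Y" "(i, Suc k) \<notin> Y"
    using ik by (auto simp: X_def Y_def)
  have "dream_perm n E = rows_perm n X (Suc i) (Suc n) \<circ> adj (i + k) \<circ> rows_perm n X 1 (Suc i)"
    unfolding X_def by (rule dream_perm_lift[of i j n k E]) (use bounds ij mid jk nE in auto)
  also have "\<dots> = dream_perm n Y"
    unfolding XY rows_perm_insert_above rows_perm_insert[OF bounds(1-3) Y] dream_perm_split[OF bounds(1,4)]
    by (simp only: comp_assoc adj_comp_adj)
  finally have "dream_perm n E = dream_perm n Y" .
  moreover have "Y \<subset> E"
    using jk by (auto simp: X_def Y_def)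
  ultimately show False
    using fpf_dream_minimal[OF n E] E by (metis fpf_dream_def)
qed

text \<open>From the gap \<open>(i, k)\<close> one descends to the first row \<open>j\<close> that
  does not contain both columns. Either the inverse move into \<open>(j, k)\<close> is possible, or
  row \<open>j\<close> has the same gap and the search continues there.\<close>

lemma fpf_dream_inverse_ladder_PD:
  assumes n: "even n" and E: "fpf_dream n z E"
    and ik: "(i, k + 1) \<in> E" "(i, k) \<notin> E" and k: "1 \<le> k"
  shows "\<exists>i j k. i < j \<and> j \<le> n \<and> (i, k + 1) \<in> E \<and> (j, k) \<notin> E \<and>
    insert (j, k) (E - {(i, k + 1)}) \<subseteq> strict_lower n \<and> ladder_PD (insert (j, k) (E - {(i, k + 1)})) E"
  using ik k
proof (induction "n - i" arbitrary: i k rule: less_induct)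
  case less
  have E_sub: "E \<subseteq> strict_lower n" and tri: "\<And>p q. (p, q) \<in> E \<Longrightarrow> p + q \<le> n"
    using E by (auto simp: fpf_dream_def)
  have "i \<le> n" "(Suc n, k) \<notin> E"
    using E_sub less.prems(1) by (auto simp: strict_lower_def)
  then have ex: "\<exists>j>i. \<not> ((j, k) \<in> E \<and> (j, k + 1) \<in> E)"
    by (intro exI[of _ "Suc n"]) auto
  define j where "j = (LEAST j. i < j \<and> \<not> ((j, k) \<in> E \<and> (j, k + 1) \<in> E))"
  have j: "i < j" "\<not> ((j, k) \<in> E \<and> (j, k + 1) \<in> E)"
    using LeastI_ex[OF ex] unfolding j_def by auto
  have "(r, k) \<in> E \<and> (r, k + 1) \<in> E" if "i < r" "r < j" for r
    using not_less_Least[of r "\<lambda>j. i < j \<and> \<not> ((j, k) \<in> E \<and> (j, k + 1) \<in> E)"] that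
    unfolding j_def by auto
  then have mid: "{i + 1..j - 1} \<times> {k, k + 1} \<subseteq> E"
    by auto
  \<comment> \<open>This cell lies on the antidiagonal of \<open>(j, k)\<close> and so bounds
    \<open>j\<close>.\<close>
  have above: "(j - 1, k + 1) \<in> E"
  proof (cases "j = Suc i")
    case False
    then show ?thesis
      using j by (intro subsetD[OF mid]) auto
  qed (use less.prems in simp)
  have jn: "j \<le> n"
    using tri[OF above] j by linarith
  have jk: "(j, k) \<notin> E"
    using fpf_dream_no_double_crossing[OF n E j(1) mid less.prems(1,2)] j(2) by auto
  show ?case
  proof (cases "(j, k + 1) \<in> E")
    case True
    then show ?thesis
      using less.hyps[of j k] j(1) jn jk less.prems(3) by auto
  next
    case False
    let ?D = "insert (j, k) (E - {(i, k + 1)})"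
    have D: "?D \<subseteq> strict_lower n"
      using E_sub less.prems j(1) jn by (auto simp: strict_lower_def)
    have "strict_lower n \<subseteq> pos_quadrant"
      by (auto simp: strict_lower_def pos_quadrant_def)
    then have "?D \<subseteq> pos_quadrant" "E \<subseteq> pos_quadrant"
      using D E_sub by auto
    moreover have "E = ?D - {(j, k)} \<union> {(i, k + 1)}"
      using jk less.prems(1) j(1) by auto
    moreover have "{i + 1..j - 1} \<times> {k, k + 1} \<subseteq> ?D"
      using mid by auto
    moreover have "(i, k) \<notin> ?D" "(i, k + 1) \<notin> ?D" "(j, k + 1) \<notin> ?D"
      using less.prems j(1) False by auto
    ultimately have "ladder_PD ?D E"
      unfolding ladder_PD_def using j(1) by blast
    with D j(1) jn jk less.prems(1) show ?thesis
      by blast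
  qed
qed

section \<open>Lehmer codes and left-justified sets\<close>

text \<open>Consecutive letters multiply to a cycle; a left-justified row spells such a
  word.\<close>

lemma word_perm_upt:
  "i \<le> m \<Longrightarrow> word_perm [i..<m] x = (if x = m then i else if i \<le> x \<and> x < m then Suc x else x)"
  by (induction m arbitrary: x rule: dec_induct) (auto simp: transpose_def)

text \<open>For a permutation of \<open>{1..n}\<close> this is the usual Lehmer code of
  \<open>inv W\<close>; position \<open>0\<close> adds nothing, because
  \<open>W 0 = 0\<close>.\<close>

definition lehmer :: "(nat \<Rightarrow> nat) \<Rightarrow> nat \<Rightarrow> nat" where
  "lehmer W i = card {y. y < inv W i \<and> i < W y}"

text \<open>The values below \<open>i\<close> occupy the same positions in both, and the code of
  \<open>i\<close> counts the other positions before that of \<open>i\<close>. An earlier position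
  of \<open>i\<close> in \<open>V\<close> would itself be counted for \<open>W\<close>, besides all
  those counted for \<open>V\<close>.\<close>

lemma lehmer_inject_aux:
  assumes V: "V permutes {1..n}" and W: "W permutes {1..n}"
    and eq: "lehmer V i = lehmer W i" and same: "\<And>p. p < i \<Longrightarrow> inv V p = inv W p"
  shows "\<not> inv V i < inv W i"
proof
  assume less: "inv V i < inv W i"
  note invs = permutes_inverses[OF V] permutes_inverses[OF W]
  have low: "V y < i \<longleftrightarrow> W y < i" for y
    using same invs by metis
  have V_set: "{y. y < inv V i \<and> i < V y} = {y. y < inv V i \<and> \<not> V y < i}"
    using invs(2) by (auto simp: not_less le_less)
  have W_set: "{y. y < inv W i \<and> i < W y} = {y. y < inv W i \<and> \<not> W y < i}"
    using invs(4) by (auto simp: not_less le_less)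
  have "{y. y < inv V i \<and> \<not> V y < i} \<subset> {y. y < inv W i \<and> \<not> W y < i}"
  proof
    show "{y. y < inv V i \<and> \<not> V y < i} \<subseteq> {y. y < inv W i \<and> \<not> W y < i}"
      using less low by auto
    have "inv V i \<in> {y. y < inv W i \<and> \<not> W y < i}"
      using less low[of "inv V i"] invs(1)[of i] by simp
    then show "{y. y < inv V i \<and> \<not> V y < i} \<noteq> {y. y < inv W i \<and> \<not> W y < i}"
      by blast
  qed
  then have "card {y. y < inv V i \<and> \<not> V y < i} < card {y. y < inv W i \<and> \<not> W y < i}"
    by (rule psubset_card_mono[rotated]) simp
  then show False
    using eq by (simp only: lehmer_def V_set W_set)
qed

lemma lehmer_inject:
  assumes V: "V permutes {1..n}" and W: "W permutes {1..n}"
    and eq: "\<And>i. i \<in> {1..n} \<Longrightarrow> lehmer V i = lehmer W i"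
  shows "V = W"
proof -
  have "inv V i = inv W i" for i
  proof (induction i rule: less_induct)
    case (less i)
    show ?case
    proof (cases "i \<in> {1..n}")
      case True
      then show ?thesis
        using lehmer_inject_aux[OF V W eq[OF True]] lehmer_inject_aux[OF W V eq[OF True, symmetric]] less
        by (metis linorder_neqE_nat)
    next
      case False
      then show ?thesis
        using permutes_not_in[OF permutes_inv[OF V]] permutes_not_in[OF permutes_inv[OF W]] by simp
    qed
  qed
  then have "inv V = inv W"
    by (rule ext)
  then show ?thesis
    by (metis permutes_inv_inv[OF V] permutes_inv_inv[OF W])
qed

text \<open>Reading row \<open>i\<close> moves the label at position \<open>i + c i\<close> to its final position \<open>i\<close>, and
  the labels it passes are the smaller ones that have not reached their final position.\<close>

lemma lehmer_dream_perm:
  assumes c: "\<And>i. i \<in> {1..n} \<Longrightarrow> i + c i \<le> n" and E: "E = {(i, k). i \<in> {1..n} \<and> 1 \<le> k \<and> k \<le> c i}"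
    and i: "i \<in> {1..n}"
  shows "lehmer (dream_perm n E) i = c i"
proof -
  \<comment> \<open>\<open>V i\<close> collects the rows \<open>1\<close> to \<open>i\<close>, which
    act first; \<open>R i\<close> is the cycle spelled by row \<open>i\<close>.\<close>
  define V where "V i = rows_perm n E 1 (Suc i)" for i
  define R where "R i x = (if x = i + c i then i else if i \<le> x \<and> x < i + c i then Suc x else x)" for i x
  have V0: "V 0 = id"
    by (simp add: V_def)
  have VSuc: "V (Suc m) x = R (Suc m) (V m x)" if "Suc m \<le> n" for m x
  proof -
    have k: "filter (\<lambda>j. (Suc m, j) \<in> E) [1..<Suc n] = [1..<Suc (c (Suc m))]"
    proof -
      have "[1..<Suc n] = [1..<Suc (c (Suc m))] @ [Suc (c (Suc m))..<Suc n]"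
        using c[of "Suc m"] that upt_add_eq_append[of 1 "Suc (c (Suc m))" "n - c (Suc m)"] by simp
      moreover have "filter (\<lambda>j. (Suc m, j) \<in> E) [1..<Suc (c (Suc m))] = [1..<Suc (c (Suc m))]"
        using that by (intro filter_True) (auto simp: E)
      moreover have "filter (\<lambda>j. (Suc m, j) \<in> E) [Suc (c (Suc m))..<Suc n] = []"
        by (auto simp: E filter_empty_conv)
      ultimately show ?thesis
        by (simp only: filter_append append_Nil2)
    qed
    have "map (\<lambda>j. Suc m + j - 1) [1..<Suc (c (Suc m))] = [Suc m..<Suc m + c (Suc m)]"
      by (rule nth_equalityI) (auto simp del: upt_Suc)
    then have "col_word E (Suc m) 1 (Suc n) = [Suc m..<Suc m + c (Suc m)]"
      by (simp only: col_word_def k)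
    then show ?thesis
      by (simp add: V_def rows_word_Suc word_perm_upt R_def del: upt_Suc)
  qed
  \<comment> \<open>Labels that are not yet in final position keep their original order.\<close>
  have mono: "V m x < V m y" if "m \<le> n" "x < y" "m < V m x" "m < V m y" for m x y
    using that
  proof (induction m)
    case (Suc m)
    then have "m < V m x" "m < V m y"
      by (auto simp: VSuc R_def split: if_splits)
    with Suc show ?case
      by (auto simp: VSuc R_def split: if_splits)
  qed (simp add: V0)
  \<comment> \<open>After row \<open>m\<close> the positions up to \<open>m\<close> are final, and
    labels beyond them stay beyond.\<close>
  have final: "(V m x \<le> m \<longrightarrow> V p x = V m x) \<and> (m < V m x \<longrightarrow> m < V p x)" if "m \<le> p" "p \<le> n" for m p x
    using that
  proof (induction p rule: dec_induct)
    case (step p)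
    then show ?case
      by (auto simp: VSuc R_def)
  qed simp
  have perm: "V m permutes {1..n}" if "m \<le> n" for m
    unfolding V_def using that c by (intro word_perm_permutes) (fastforce simp: set_rows_word E)
  obtain m where m: "i = Suc m" "Suc m \<le> n"
    using i by (cases i) auto
  define x where "x = inv (V n) i"
  have x: "V n x = i"
    unfolding x_def by (rule permutes_inverses(1)[OF perm]) simp
  have "m < V m x"
    using final[of m n x] x m by (cases "m < V m x") auto
  have "V i x \<le> i"
    using final[of i n x] x i by (cases "i < V i x") auto
  then have "V i x = i"
    using final[of i n x] x i by auto
  with \<open>m < V m x\<close> have Vx: "V m x = i + c i"
    using m by (auto simp: VSuc R_def split: if_splits)
  \<comment> \<open>The labels before \<open>x\<close> that end behind \<open>i\<close> are those
    passed while reading row \<open>i\<close>.\<close>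
  have "y < x \<and> i < V n y \<longleftrightarrow> V m y \<in> {i..<i + c i}" for y
  proof
    assume y: "y < x \<and> i < V n y"
    then have "m < V m y"
      using final[of m n y] m by (cases "m < V m y") auto
    with y \<open>m < V m x\<close> show "V m y \<in> {i..<i + c i}"
      using mono[of m y x] m Vx by auto
  next
    assume y: "V m y \<in> {i..<i + c i}"
    then have "i < V i y"
      using m by (simp add: VSuc R_def)
    moreover have "y < x"
      using y Vx mono[of m x y] m by (cases x y rule: linorder_cases) auto
    ultimately show "y < x \<and> i < V n y"
      using final[of i n y] i by auto
  qed
  then have "{y. y < x \<and> i < V n y} = V m -` {i..<i + c i}"
    unfolding vimage_def by (simp only:)
  moreover have "card (V m -` {i..<i + c i}) = card {i..<i + c i}"
    using perm[of m] m by (intro card_vimage_inj) (auto simp: permutes_inj permutes_surj)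
  ultimately show ?thesis
    by (simp add: lehmer_def x_def V_def)
qed

text \<open>The counterpart of \<open>fpf_dream_no_double_crossing\<close> for the second move. The
  tail would be \<open>a + 1, a - 1, a\<close>, and the product of its first two letters commutes
  with the conjugate of \<theta> by \<open>adj a\<close>; so \<open>(j, k)\<close> and
  \<open>(i, k - 1)\<close> could be deleted.\<close>

lemma fpf_dream_no_double_block:
  assumes n: "even n" and E: "fpf_dream n z E" and ij: "i < j" and k: "2 \<le> k"
    and mid: "{i + 1..j - 1} \<times> {k, k + 1} \<subseteq> E"
    and ik: "(i, k - 1) \<in> E" "(i, k) \<in> E" "(i, k + 1) \<notin> E" "(i, k + 2) \<notin> E"
    and clear: "\<And>p q. p < i \<Longrightarrow> (p, q) \<in> E \<Longrightarrow> p + q + 2 < i + k \<or> i + k + 2 < p + q"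
    and a: "even (i + k - 1)" and jk: "(j, k) \<in> E"
  shows "(j, k + 1) \<in> E"
proof (rule ccontr)
  assume nE: "(j, k + 1) \<notin> E"
  define X where "X = E - {(j, k), (i, k), (i, k - 1)}"
  define a where "a = i + k - 1"
  define M where "M = dream_perm n X"
  have E_sub: "E \<subseteq> strict_lower n" and tri: "j + k \<le> n"
    using E jk by (auto simp: fpf_dream_def)
  then have bounds: "1 \<le> i" "i \<le> n" "j \<le> n" "1 \<le> k" "k < n" "k \<le> n"
    using ik ij jk by (auto simp: strict_lower_def)
  have X: "X \<subseteq> strict_lower n" "(i, k - 1) \<notin> X" "(i, k) \<notin> X" "(i, k + 1) \<notin> X" "(i, k + 2) \<notin> X"
    using ik E_sub by (auto simp: X_def)
  have clear_X: "p + q + 2 < i + k \<or> i + k + 2 < p + q" if "p < i" "(p, q) \<in> X" for p q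
    using clear that by (simp add: X_def)
  have EX: "E - {(j, k)} = insert (i, k - 1) (insert (i, k) X)"
    using ik ij by (auto simp: X_def)
  have a1: "i + k = a + 1"
    using bounds by (simp add: a_def)
  note row = clear_row_perms[OF X(1) bounds(1,2) k bounds(6) X(2-5) clear_X, folded a_def M_def]
  have "dream_perm n E = rows_perm n (E - {(j, k)}) (Suc i) (Suc n) \<circ> adj (a + 1) \<circ>
      rows_perm n (E - {(j, k)}) 1 (Suc i)"
    unfolding a1[symmetric] by (rule dream_perm_lift[of i j n k E]) (use bounds ij mid jk nE in auto)
  also have "\<dots> = M \<circ> (adj (a + 1) \<circ> adj (a - 1) \<circ> adj a)"
    unfolding EX rows_perm_insert_above by (rule row(5))
  finally have perm: "dream_perm n E = M \<circ> (adj (a + 1) \<circ> adj (a - 1) \<circ> adj a)" .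
  have inverse: "(adj b \<circ> adj c \<circ> adj d) \<circ> (adj d \<circ> adj c \<circ> adj b) = id" for b c d
    by (simp only: comp_assoc adj_comp_adj)
  have even_a: "even a" "2 \<le> a" "a + 2 \<le> n"
    using tri ij(1) k a1 bounds(1) by (unfold a_def, intro a, linarith+)
  have "z \<circ> dream_perm n E = dream_perm n E \<circ> theta n"
    using E by (simp add: fpf_dream_def)
  then have "z \<circ> M = M \<circ> (adj a \<circ> theta n \<circ> adj a)"
    unfolding perm intertwine_comp[OF inverse inverse] theta_block(2)[OF even_a n] .
  then have "z \<circ> (M \<circ> adj a) = (M \<circ> adj a) \<circ> theta n"
    unfolding intertwine_comp[OF adj_comp_adj(1) adj_comp_adj(1)] .
  moreover have "dream_perm n (insert (i, k) X) = M \<circ> adj a"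
    by (rule row(2))
  moreover have "insert (i, k) X \<subset> E"
  proof
    show "insert (i, k) X \<subseteq> E"
      using ik by (auto simp: X_def)
    have "(j, k) \<notin> insert (i, k) X"
      using ij by (simp add: X_def)
    with jk show "insert (i, k) X \<noteq> E"
      by metis
  qed
  ultimately show False
    using fpf_dream_minimal[OF n E] by metis
qed

text \<open>\<theta> absorbs \<open>adj a\<close>, so a descent within a pair would yield a shorter
  intertwining permutation, and \<open>z\<close> would have too few inversions.\<close>

lemma fpf_dream_pair_less:
  assumes n: "even n" and E: "fpf_dream n z E" and a: "odd a" "a < n"
  shows "dream_perm n E a < dream_perm n E (Suc a)"
proof (rule ccontr)
  let ?W = "dream_perm n E"
  assume "\<not> ?W a < ?W (Suc a)"
  have E': "E \<subseteq> strict_lower n" "\<forall>(i, j)\<in>E. i + j \<le> n"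
    using E by (auto simp: fpf_dream_def)
  note W = dream_perm_permutes[OF E']
  have desc: "?W (Suc a) < ?W a"
    using \<open>\<not> ?W a < ?W (Suc a)\<close> injD[OF permutes_inj[OF W], of a "Suc a"]
    by (cases "?W a" "?W (Suc a)" rule: linorder_cases) auto
  have a1: "1 \<le> a"
    using a by (cases a) auto
  have "z \<circ> ?W = ?W \<circ> theta n"
    using E by (simp add: fpf_dream_def)
  then have "z \<circ> (?W \<circ> adj a) = (?W \<circ> adj a) \<circ> theta n"
    unfolding intertwine_comp[OF adj_comp_adj(1) adj_comp_adj(1)] theta_adj_odd[OF a] .
  then have "card (inversions n z) \<le> 2 * card (inversions n (?W \<circ> adj a)) + n div 2"
    by (intro card_inversions_conj_le n permutes_compose adj_permutes a1 a W)
  moreover have "card (inversions n (?W \<circ> adj a)) < card (inversions n ?W)"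
    by (rule card_inversions_comp_adj_less[where f = ?W, OF a1 a(2) desc])
  moreover have "card (inversions n ?W) \<le> card E"
    using card_inversions_word_perm[OF set_dream_word[OF E']] length_rows_word[OF E'(1)] by simp
  ultimately show False
    using E by (simp add: fpf_dream_def)
qed

lemma theta_pair:
  assumes "even n" "y \<in> {1..n}"
  obtains r where "r < n div 2" "y = 2 * r + 1" "theta n y = 2 * r + 2"
  | r where "r < n div 2" "y = 2 * r + 2" "theta n y = 2 * r + 1"
proof (cases "odd y")
  case True
  then obtain r where r: "y = 2 * r + 1"
    by (rule oddE)
  then show ?thesis
    using assms by (intro that(1)[of r]) (auto simp: theta_def elim!: evenE)
next
  case False
  then obtain s where "y = 2 * s"
    by (auto elim: evenE)
  then obtain r where r: "y = 2 * r + 2"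
    using assms(2) by (cases s) auto
  then show ?thesis
    using assms by (intro that(2)[of r]) (auto simp: theta_def)
qed

text \<open>With the cycles listed by their smaller elements, a label \<open>y\<close> with value
  above \<open>i\<close> stands before the label of \<open>i\<close> exactly if its cycle comes
  before that of \<open>i\<close>. In that case \<open>W y\<close> is the larger element of its
  cycle, and its partner lies below both \<open>i\<close> and \<open>z i\<close>.\<close>

lemma lehmer_eq_fpf_code:
  assumes n: "even n" and W: "W permutes {1..n}" and zW: "z \<circ> W = W \<circ> theta n"
    and pair: "\<And>m. m < n div 2 \<Longrightarrow> W (2 * m + 1) < W (2 * m + 2)"
    and sorted: "\<And>m m'. m < m' \<Longrightarrow> m' < n div 2 \<Longrightarrow> W (2 * m + 1) < W (2 * m' + 1)"
    and i: "i \<in> {1..n}"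
  shows "lehmer W i = fpf_code n z i"
proof -
  define x where "x = inv W i"
  have x: "x \<in> {1..n}" "W x = i"
    using permutes_in_image[OF permutes_inv[OF W]] permutes_inverses[OF W] i by (auto simp: x_def)
  have z: "z (W y) = W (theta n y)" for y
    using fun_cong[OF zW, of y] by simp
  have key: "y < x \<longleftrightarrow> z (W y) < z i \<and> z (W y) < i" if y: "y \<in> {1..n}" "i < W y" for y
  proof -
    have mono: "W (2 * r + 1) < W (2 * s + 1) \<longleftrightarrow> r < s" if "r < n div 2" "s < n div 2" for r s
      using sorted that by (cases r s rule: linorder_cases) (auto dest: less_asym)
    obtain r where r: "r < n div 2" "y = 2 * r + 1 \<and> theta n y = 2 * r + 2 \<or> y = 2 * r + 2 \<and> theta n y = 2 * r + 1"
      using theta_pair[OF n y(1)] by metis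
    obtain s where s: "s < n div 2" "x = 2 * s + 1 \<and> theta n x = 2 * s + 2 \<or> x = 2 * s + 2 \<and> theta n x = 2 * s + 1"
      using theta_pair[OF n x(1)] by metis
    have less: "W x < W y"
      using y(2) x(2) by simp
    have "y < x \<longleftrightarrow> W (theta n y) < W (theta n x) \<and> W (theta n y) < W x"
      using r(2) s(2) less pair[OF r(1)] pair[OF s(1)] mono[OF r(1) s(1)] mono[OF s(1) r(1)]
      by (cases r s rule: linorder_cases) (elim disjE conjE; simp)+
    then show ?thesis
      unfolding x(2)[symmetric] z .
  qed
  have range: "y \<in> {1..n}" if "i < W y" "y < x" for y
    using that x(1) permutes_not_in[OF W, of y] by (cases "y = 0") auto
  have Win: "W y \<in> {1..n} \<longleftrightarrow> y \<in> {1..n}" for y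
    by (rule permutes_in_image[OF W])
  have "W ` {y. y < x \<and> i < W y} = {j \<in> {1..n}. j > i \<and> z i > z j \<and> i > z j}"
  proof safe
    fix y assume y: "y < x" "i < W y"
    note r = range[OF y(2,1)]
    show "W y \<in> {1..n}"
      using r Win by blast
    show "z (W y) < z i" "z (W y) < i"
      using key[OF r y(2)] y(1) by auto
  next
    fix j assume j: "j \<in> {1..n}" "i < j" "z j < z i" "z j < i"
    have Wj: "W (inv W j) = j"
      by (rule permutes_inverses(1)[OF W])
    then have "inv W j \<in> {1..n}"
      using Win[of "inv W j"] j(1) by simp
    then have "inv W j < x"
      using key[of "inv W j"] j by (simp add: Wj)
    then show "j \<in> W ` {y. y < x \<and> i < W y}"
      using j by (intro image_eqI[of _ _ "inv W j"]) (simp_all add: Wj)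
  qed
  moreover have "card (W ` {y. y < x \<and> i < W y}) = card {y. y < x \<and> i < W y}"
    by (rule card_image) (rule inj_on_subset[OF permutes_inj[OF W] subset_UNIV])
  ultimately show ?thesis
    by (simp add: lehmer_def fpf_code_def x_def)
qed

lemma left_justified_code:
  assumes E: "fpf_dream n z E" and left: "\<And>i k. 1 \<le> k \<Longrightarrow> (i, k + 1) \<in> E \<Longrightarrow> (i, k) \<in> E"
  obtains c where "E = {(i, k). i \<in> {1..n} \<and> 1 \<le> k \<and> k \<le> c i}"
    "\<And>i. i \<in> {1..n} \<Longrightarrow> i + c i \<le> n"
proof -
  have E_sub: "E \<subseteq> strict_lower n" and tri: "\<And>p q. (p, q) \<in> E \<Longrightarrow> p + q \<le> n"
    using E by (auto simp: fpf_dream_def)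
  \<comment> \<open>The inserted \<open>0\<close> is the length of an empty row.\<close>
  define c where "c i = Max (insert 0 {k. (i, k) \<in> E})" for i
  have fin: "finite {k. (i, k) \<in> E}" for i
    by (rule finite_subset[of _ "{..n}"]) (use E_sub in \<open>auto simp: strict_lower_def\<close>)
  have le: "k \<le> c i" if "(i, k) \<in> E" for i k
    unfolding c_def using fin that by (intro Max_ge) auto
  have c_in: "(i, c i) \<in> E" if "c i \<noteq> 0" for i
    using Max_in[of "insert 0 {k. (i, k) \<in> E}"] fin[of i] that by (auto simp: c_def)
  have down: "(i, k) \<in> E" if "1 \<le> k" "k \<le> c i" for i k
    using that(2,1)
  proof (induction k rule: inc_induct)
    case base
    then show ?case by (intro c_in) auto
  next
    case (step k)
    then show ?case using left[of k i] by simp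
  qed
  show ?thesis
  proof (rule that[of c])
    show "E = {(i, k). i \<in> {1..n} \<and> 1 \<le> k \<and> k \<le> c i}"
      using E_sub le down by (fastforce simp: strict_lower_def)
    show "i + c i \<le> n" if "i \<in> {1..n}" for i
      using that tri[OF c_in, of i] by (cases "c i = 0") auto
  qed
qed

text \<open>The move starts in row \<open>i = W (2 * m + 1)\<close>, the smallest value at which
  consecutive pairs are out of order, with \<open>k\<close> the length of that row. This choice
  gives \<open>i + k - 1 = 2 * m\<close>, which is even, and keeps the rows above off the nearby
  antidiagonals.\<close>

lemma fpf_dream_inverse_ladder_FD:
  assumes n: "even n" and E: "fpf_dream n z E"
    and E_eq: "E = {(i, k). i \<in> {1..n} \<and> 1 \<le> k \<and> k \<le> c i}"
    and c: "\<And>i. i \<in> {1..n} \<Longrightarrow> i + c i \<le> n"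
    and ex: "1 \<le> m0" "m0 < n div 2" "dream_perm n E (2 * m0 + 1) < dream_perm n E (2 * m0 - 1)"
  shows "\<exists>i j k. i < j \<and> j \<le> n \<and> (i, k - 1) \<in> E \<and> (j, k) \<notin> E \<and>
    insert (j, k) (E - {(i, k - 1)}) \<subseteq> strict_lower n \<and> ladder_FD (insert (j, k) (E - {(i, k - 1)})) E"
proof -
  define W where "W = dream_perm n E"
  define desc where "desc m \<longleftrightarrow> 1 \<le> m \<and> m < n div 2 \<and> W (2 * m + 1) < W (2 * m - 1)" for m
  have "desc m0"
    using ex by (simp add: desc_def W_def)
  \<comment> \<open>The descent is chosen minimal in value, not in index.\<close>
  then obtain m where m: "desc m" and least: "\<And>m'. desc m' \<Longrightarrow> W (2 * m + 1) \<le> W (2 * m' + 1)"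
    using ex_has_least_nat[of desc m0 "\<lambda>m. W (2 * m + 1)"] by auto
  have E_sub: "E \<subseteq> strict_lower n" and tri: "\<And>p q. (p, q) \<in> E \<Longrightarrow> p + q \<le> n"
    using E by (auto simp: fpf_dream_def)
  have W: "W permutes {1..n}"
    unfolding W_def using E by (intro dream_perm_permutes) (auto simp: fpf_dream_def)
  have Win: "W y \<in> {1..n} \<longleftrightarrow> y \<in> {1..n}" for y
    by (rule permutes_in_image[OF W])
  have inj: "W x = W y \<longleftrightarrow> x = y" for x y
    using permutes_inj[OF W] by (auto dest: injD)
  have pair: "W (2 * r + 1) < W (2 * r + 2)" if "r < n div 2" for r
    using fpf_dream_pair_less[OF n E, of "2 * r + 1"] that n by (auto simp: W_def elim!: evenE)
  define i where "i = W (2 * m + 1)"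
  have m_bounds: "1 \<le> m" "2 * m + 2 \<le> n" "i < W (2 * m - 1)"
    using m n by (auto simp: desc_def i_def elim!: evenE)
  have i_in: "i \<in> {1..n}"
    unfolding i_def Win using m_bounds by auto
  have inv_i: "inv W i = 2 * m + 1"
    unfolding i_def by (rule permutes_inverses(2)[OF W])
  \<comment> \<open>A label pair beyond \<open>m\<close> starting before \<open>i\<close> would force a descent of smaller value.\<close>
  have low: "y + 2 \<le> 2 * m" if y: "y \<in> {1..n}" "W y < i" for y
  proof (rule ccontr)
    assume "\<not> ?thesis"
    obtain r where r: "r < n div 2" "W (2 * r + 1) < i" "y \<le> 2 * r + 2"
      by (rule theta_pair[OF n y(1)]) (use y(2) pair in force)+
    with \<open>\<not> ?thesis\<close> have "m - 1 \<le> r"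
      by simp
    moreover have "r \<noteq> m - 1"
    proof
      assume "r = m - 1"
      then have "2 * r + 1 = 2 * m - 1"
        using m_bounds by simp
      with r(2) m_bounds(3) show False
        by simp
    qed
    moreover have "r \<noteq> m"
      using r(2) by (auto simp: i_def)
    ultimately have "m < r"
      by simp
    define M where "M = (LEAST M. m < M \<and> W (2 * M + 1) < i)"
    have M: "m < M" "W (2 * M + 1) < i" "M \<le> r"
      unfolding M_def using LeastI[of "\<lambda>M. m < M \<and> W (2 * M + 1) < i" r] \<open>m < r\<close> r(2)
        Least_le[of "\<lambda>M. m < M \<and> W (2 * M + 1) < i" r] by auto
    have "\<not> (m < M - 1 \<and> W (2 * (M - 1) + 1) < i)"
      using not_less_Least[of "M - 1" "\<lambda>M. m < M \<and> W (2 * M + 1) < i"] M(1) by (simp add: M_def)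
    then have "i \<le> W (2 * (M - 1) + 1)"
      using M(1) by (cases "m = M - 1") (auto simp: i_def)
    moreover have "2 * (M - 1) + 1 = 2 * M - 1"
      using M(1) by simp
    ultimately have "desc M"
      using M r(1) by (simp add: desc_def)
    then show False
      using least[of M] M(2) by (simp add: i_def)
  qed
  have card_le: "card {y \<in> {1..n}. W y \<le> p} = p" if "p \<le> n" for p
  proof -
    have "{y \<in> {1..n}. W y \<le> p} = W -` {1..p}"
    proof (rule set_eqI)
      fix y
      show "y \<in> {y \<in> {1..n}. W y \<le> p} \<longleftrightarrow> y \<in> W -` {1..p}"
        using Win[of y] that by auto
    qed
    then show ?thesis
      using card_vimage_inj[OF permutes_inj[OF W], of "{1..p}"] permutes_surj[OF W] by simp
  qed
  have code: "card {y. y < inv W p \<and> p < W y} = c p" if "p \<in> {1..n}" for p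
    using lehmer_dream_perm[OF c E_eq that] by (simp add: lehmer_def W_def)
  have W0: "W 0 = 0"
    using permutes_not_in[OF W] by simp
  \<comment> \<open>Each of the labels \<open>1\<close> to \<open>2 * m\<close> has either a larger
    value than \<open>i\<close>, and there are \<open>c i\<close> of those, or one of the
    \<open>i - 1\<close> smaller values, all of which occur there by \<open>low\<close>.\<close>
  have ci: "c i + i = 2 * m + 1"
  proof -
    let ?A = "{y. y < 2 * m + 1 \<and> i < W y}" and ?B = "{y \<in> {1..n}. W y \<le> i - 1}"
    have B: "y \<in> {1..2 * m}" if "y \<in> ?B" for y
    proof -
      have "W y < i"
        using that i_in by auto
      then show ?thesis
        using low[of y] that by auto
    qed
    have "?A \<union> ?B = {1..2 * m}"
    proof (intro equalityI subsetI)
      fix y assume "y \<in> {1..2 * m}"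
      moreover from this have "W y \<noteq> i"
        unfolding i_def inj by simp
      ultimately show "y \<in> ?A \<union> ?B"
        using m_bounds by (cases "i < W y") auto
    next
      fix y assume "y \<in> ?A \<union> ?B"
      then show "y \<in> {1..2 * m}"
        using B[of y] W0 by (cases "y = 0") auto
    qed
    moreover have "card (?A \<union> ?B) = card ?A + card ?B"
      by (rule card_Un_disjoint) auto
    ultimately have "2 * m = card ?A + card ?B"
      by simp
    moreover have "card ?A = c i"
      using code[OF i_in] by (simp only: inv_i)
    moreover have "card ?B = i - 1"
      using i_in by (intro card_le) auto
    ultimately show ?thesis
      using i_in by simp
  qed
  \<comment> \<open>The same count for row \<open>p\<close>: the labels with values up to
    \<open>p\<close> and those counted by \<open>c p\<close> all lie in
    \<open>{1..2 * m - 2}\<close>.\<close>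
  have above: "p + q + 2 \<le> 2 * m" if pq: "p < i" "(p, q) \<in> E" for p q
  proof -
    have p: "p \<in> {1..n}" "q \<le> c p"
      using pq by (auto simp: E_eq)
    let ?A = "{y. y < inv W p \<and> p < W y}" and ?B = "{y \<in> {1..n}. W y \<le> p}"
    have "W (inv W p) = p"
      by (rule permutes_inverses(1)[OF W])
    then have "inv W p + 2 \<le> 2 * m"
      using Win[of "inv W p"] p(1) pq(1) by (intro low) auto
    then have "y \<in> {1..2 * m - 2}" if "y \<in> ?A" for y
      using that W0 by (cases "y = 0") auto
    moreover have "y \<in> {1..2 * m - 2}" if "y \<in> ?B" for y
    proof -
      have "y + 2 \<le> 2 * m" "1 \<le> y"
        using low[of y] that pq by auto
      then show ?thesis
        by simp
    qed
    ultimately have "?A \<union> ?B \<subseteq> {1..2 * m - 2}"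
      by blast
    then have "card (?A \<union> ?B) \<le> 2 * m - 2"
      using card_mono[of "{1..2 * m - 2}"] by fastforce
    moreover have "card (?A \<union> ?B) = card ?A + card ?B"
      by (rule card_Un_disjoint) auto
    moreover have "card ?B = p"
      using p by (intro card_le) auto
    ultimately show ?thesis
      using code[OF p(1)] p m_bounds by simp
  qed
  define k where "k = c i"
  \<comment> \<open>Both labels of the preceding pair have values above \<open>i\<close>, so the row
    has length at least two.\<close>
  have "{2 * m - 1, 2 * m} \<subseteq> {y. y < inv W i \<and> i < W y}"
  proof -
    have "2 * (m - 1) + 1 = 2 * m - 1" "2 * (m - 1) + 2 = 2 * m" "m - 1 < n div 2"
      using m_bounds by auto
    then have "W (2 * m - 1) < W (2 * m)"
      using pair[of "m - 1"] by metis
    then show ?thesis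
      using m_bounds by (auto simp: inv_i)
  qed
  then have "card {2 * m - 1, 2 * m} \<le> k"
    unfolding k_def code[OF i_in, symmetric] by (intro card_mono) auto
  then have k2: "2 \<le> k"
    using m_bounds by (simp add: card_insert_if split: if_splits)
  have "i < W (2 * m + 2)"
    using pair[of m] m_bounds by (simp add: i_def)
  moreover have "W (2 * m + 2) \<in> {1..n}"
    unfolding Win using m_bounds by simp
  ultimately have "i < n"
    by simp
  have "c n = 0"
    using c[of n] m_bounds by simp
  then have ex_j: "\<exists>j>i. c j \<le> k"
    using \<open>i < n\<close> by (intro exI[of _ n]) simp
  \<comment> \<open>The first row below \<open>i\<close> of length at most \<open>k\<close>; it
    exists since row \<open>n\<close> is empty.\<close>
  define j where "j = (LEAST j. i < j \<and> c j \<le> k)"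
  have j: "i < j" "c j \<le> k"
    unfolding j_def using LeastI_ex[OF ex_j] by auto
  have "j \<le> n"
    unfolding j_def by (rule Least_le) (simp add: \<open>i < n\<close> \<open>c n = 0\<close>)
  have mid: "{i + 1..j - 1} \<times> {k, k + 1} \<subseteq> E"
  proof
    fix x assume x: "x \<in> {i + 1..j - 1} \<times> {k, k + 1}"
    then have "i < fst x" "fst x < j" "snd x = k \<or> snd x = k + 1"
      using j(1) by auto
    moreover from this have "\<not> c (fst x) \<le> k"
      using not_less_Least[of "fst x" "\<lambda>j. i < j \<and> c j \<le> k"] by (simp add: j_def)
    ultimately show "x \<in> E"
      using k2 \<open>j \<le> n\<close> by (cases x) (auto simp: E_eq)
  qed
  have ik: "(i, k - 1) \<in> E" "(i, k) \<in> E" "(i, k + 1) \<notin> E" "(i, k + 2) \<notin> E" "(j, k + 1) \<notin> E"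
    using k2 i_in j by (auto simp: E_eq k_def)
  have a: "i + k = 2 * m + 1"
    using ci by (simp add: k_def)
  \<comment> \<open>A row \<open>j\<close> of length exactly \<open>k\<close> would be a double
    block, so its length is less than \<open>k\<close>.\<close>
  have jk: "(j, k) \<notin> E"
    using fpf_dream_no_double_block[OF n E j(1) k2 mid ik(1-4)] ik(5) above a by force
  let ?D = "insert (j, k) (E - {(i, k - 1)})"
  have D: "?D \<subseteq> strict_lower n"
    using E_sub ik(2) j(1) \<open>j \<le> n\<close> by (auto simp: strict_lower_def)
  have "strict_lower n \<subseteq> pos_quadrant"
    by (auto simp: strict_lower_def pos_quadrant_def)
  then have quadrant: "?D \<subseteq> pos_quadrant" "E \<subseteq> pos_quadrant"
    using D E_sub by auto
  have mid_D: "{i + 1..j - 1} \<times> {k, k + 1} \<subseteq> ?D"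
    using mid by auto
  have row_D: "(i, k) \<in> ?D" "(j, k) \<in> ?D" "(i, k - 1) \<notin> ?D" "(i, k + 1) \<notin> ?D" "(i, k + 2) \<notin> ?D"
    "(j, k + 1) \<notin> ?D"
    using ik j(1) k2 by auto
  have E_D: "E = ?D - {(j, k)} \<union> {(i, k - 1)}"
    using ik(1) jk by auto
  have antidiag: "?D \<inter> northeast_antidiag i l = {}" if "l \<in> {k - 2, k - 1, k, k + 1, k + 2}" for l
  proof -
    have "False" if "(p, q) \<in> E" "p < i" "p + q = i + l" for p q
      using above[OF that(2,1)] that(3) \<open>l \<in> _\<close> a k2 by auto
    then show ?thesis
      using j(1) by (auto simp: northeast_antidiag_def)
  qed
  have "0 < i"
    using i_in by simp
  have "ladder_FD ?D E"
    unfolding ladder_FD_def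
    by (rule conjI[OF quadrant(1) conjI[OF quadrant(2)]], rule exI[of _ i], rule exI[of _ j],
        rule exI[of _ k], intro conjI ballI, fact \<open>0 < i\<close>, fact j(1), fact k2, fact mid_D, (fact row_D)+,
        fact E_D, rule antidiag)
  with D j(1) \<open>j \<le> n\<close> jk ik(1) show ?thesis
    by blast
qed

section \<open>The bottom element and chains of ladder moves\<close>

text \<open>The counted \<open>j\<close> lie beyond \<open>i\<close>, and their images under
  \<open>z\<close> are distinct and below \<open>i\<close>. Hence the bottom element lies strictly
  below the diagonal and inside the triangle.\<close>

lemma fpf_code_bounds:
  assumes z: "z permutes {1..n}" and i: "i \<in> {1..n}"
  shows "fpf_code n z i < i" "i + fpf_code n z i \<le> n"
proof -
  let ?A = "{j \<in> {1..n}. j > i \<and> z i > z j \<and> i > z j}"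
  have "card ?A \<le> card {1..<i}"
  proof (rule card_inj_on_le)
    show "inj_on z ?A"
      by (rule inj_on_subset[OF permutes_inj[OF z] subset_UNIV])
    show "z ` ?A \<subseteq> {1..<i}"
      using permutes_in_image[OF z] by force
  qed simp
  then show "fpf_code n z i < i"
    using i by (auto simp: fpf_code_def)
  have "card ?A \<le> card {i<..n}"
    by (rule card_mono) auto
  then have "fpf_code n z i \<le> n - i"
    by (simp add: fpf_code_def)
  then show "i + fpf_code n z i \<le> n"
    using i by auto
qed

lemma card_left_endpoints:
  assumes z: "z permutes {1..n}" and zz: "\<And>x. z (z x) = x" and fpf: "\<And>i. i \<in> {1..n} \<Longrightarrow> z i \<noteq> i"
  shows "card {i \<in> {1..n}. i < z i} = n div 2"
proof -
  let ?A = "{i \<in> {1..n}. i < z i}"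
  have zin: "z x \<in> {1..n} \<longleftrightarrow> x \<in> {1..n}" for x
    by (rule permutes_in_image[OF z])
  have "?A \<union> z ` ?A = {1..n}"
  proof (intro equalityI subsetI)
    fix x assume x: "x \<in> {1..n}"
    show "x \<in> ?A \<union> z ` ?A"
    proof (cases "x < z x")
      case False
      then have "z x < z (z x)"
        using fpf[OF x] by (simp add: zz)
      then have "z x \<in> ?A"
        using zin[of x] x by simp
      then show ?thesis
        using zz[of x] by (metis UnI2 imageI)
    qed (use x in simp)
  qed (use zin in auto)
  moreover have "?A \<inter> z ` ?A = {}"
    by (auto simp: zz)
  moreover have "card (z ` ?A) = card ?A"
    by (rule card_image) (rule inj_on_subset[OF permutes_inj[OF z] subset_UNIV])
  ultimately have "n = card ?A + card ?A"
    using card_Un_disjoint[of ?A "z ` ?A"] by simp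
  then show ?thesis
    by simp
qed

text \<open>The involution \<open>(i, j) \<mapsto> (z j, z i)\<close> of the inversion set has the fixed points
  \<open>(i, z i)\<close> and exchanges the inversions with \<open>z j < i\<close> and those with \<open>i < z j\<close>.\<close>

lemma card_inversions_involution:
  assumes z: "z permutes {1..n}" and zz: "\<And>x. z (z x) = x" and fpf: "\<And>i. i \<in> {1..n} \<Longrightarrow> z i \<noteq> i"
  shows "card (inversions n z) = 2 * (\<Sum>i\<in>{1..n}. fpf_code n z i) + n div 2"
proof -
  let ?A = "{i \<in> {1..n}. i < z i}"
  define K where "K = {(i, j) \<in> inversions n z. z j < i}"
  define K' where "K' = {(i, j) \<in> inversions n z. i < z j}"
  define P where "P = {(i, j) \<in> inversions n z. z j = i}"
  have zin: "1 \<le> z x \<and> z x \<le> n" if "1 \<le> x" "x \<le> n" for x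
    using permutes_in_image[OF z, of x] that by auto
  have "inversions n z = K \<union> K' \<union> P"
    by (auto simp: K_def K'_def P_def)
  moreover have fin: "finite K" "finite K'" "finite P"
    unfolding K_def K'_def P_def by (rule finite_subset[OF _ finite_inversions[of n z]]; auto)+
  moreover have "K \<inter> K' = {}" "(K \<union> K') \<inter> P = {}"
    by (auto simp: K_def K'_def P_def)
  ultimately have "card (inversions n z) = card K + card K' + card P"
    by (simp add: card_Un_disjoint)
  moreover have "card K' = card K"
  proof (rule bij_betw_same_card[of "\<lambda>(i, j). (z j, z i)"])
    show "bij_betw (\<lambda>(i, j). (z j, z i)) K' K"
      by (rule bij_betw_byWitness[where f' = "\<lambda>(i, j). (z j, z i)"])
        (use zin zz in \<open>auto simp: K_def K'_def inversions_def\<close>)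
  qed
  moreover have "card P = n div 2"
  proof -
    have "P = (\<lambda>i. (i, z i)) ` ?A"
      using zin zz by (auto simp: P_def inversions_def image_iff)
    then have "card P = card ?A"
      by (simp add: card_image inj_on_def)
    then show ?thesis
      by (simp only: card_left_endpoints[OF z zz fpf])
  qed
  moreover have "card K = (\<Sum>i\<in>{1..n}. fpf_code n z i)"
  proof -
    have "K = (SIGMA i:{1..n}. {j \<in> {1..n}. j > i \<and> z i > z j \<and> i > z j})"
      by (auto simp: K_def inversions_def)
    then show ?thesis
      using card_SigmaI[of "{1..n}" "\<lambda>i. {j \<in> {1..n}. j > i \<and> z i > z j \<and> i > z j}"]
      by (simp add: fpf_code_def)
  qed
  ultimately show ?thesis
    by simp
qed

text \<open>The cycles are listed in the order of their smaller elements: \<open>2 * m + 1\<close>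
  goes to the entry of index \<open>m\<close> in the sorted list of smaller elements and
  \<open>2 * m + 2\<close> to its partner.\<close>

lemma fpf_involutions_sorted_labelling:
  assumes n: "even n" and z: "z permutes {1..n}" and zz: "\<And>x. z (z x) = x"
    and fpf: "\<And>i. i \<in> {1..n} \<Longrightarrow> z i \<noteq> i"
  obtains W where "W permutes {1..n}" "z \<circ> W = W \<circ> theta n"
    "\<And>m. m < n div 2 \<Longrightarrow> W (2 * m + 1) < W (2 * m + 2)"
    "\<And>m m'. m < m' \<Longrightarrow> m' < n div 2 \<Longrightarrow> W (2 * m + 1) < W (2 * m' + 1)"
proof -
  define l where "l = sorted_list_of_set {i \<in> {1..n}. i < z i}"
  have len: "length l = n div 2"
    by (simp only: l_def length_sorted_list_of_set card_left_endpoints[OF z zz fpf])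
  have l_in: "1 \<le> l ! m \<and> l ! m \<le> n \<and> l ! m < z (l ! m)" if "m < n div 2" for m
  proof -
    have "l ! m \<in> set l"
      using that len by simp
    then show ?thesis
      by (simp add: l_def)
  qed
  have l_less: "l ! m < l ! m'" if "m < m'" "m' < n div 2" for m m'
    using sorted_wrt_nth_less[OF strict_sorted_list_of_set[of "{i \<in> {1..n}. i < z i}"]] that len
    by (simp add: l_def)
  have l_inj: "l ! m = l ! m' \<longleftrightarrow> m = m'" if "m < n div 2" "m' < n div 2" for m m'
    using l_less[of m m'] l_less[of m' m] that by (cases m m' rule: linorder_cases) auto
  define W where "W y = (if y \<in> {1..n} then if odd y then l ! ((y - 1) div 2) else z (l ! ((y - 1) div 2)) else y)" for y
  have W1: "W (2 * m + 1) = l ! m" and W2: "W (2 * m + 2) = z (l ! m)" if "m < n div 2" for m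
    using that n by (auto simp: W_def)
  have zin: "z x \<in> {1..n} \<longleftrightarrow> x \<in> {1..n}" for x
    by (rule permutes_in_image[OF z])
  have W_in: "W y \<in> {1..n}" if "y \<in> {1..n}" for y
    by (rule theta_pair[OF n that]) (use l_in zin W1 W2 in auto)
  have "inj_on W {1..n}"
  proof (rule inj_onI)
    fix x y assume x: "x \<in> {1..n}" and y: "y \<in> {1..n}" and eq: "W x = W y"
    obtain r where r: "r < n div 2" "x = 2 * r + 1 \<or> x = 2 * r + 2"
      using theta_pair[OF n x] by metis
    obtain s where s: "s < n div 2" "y = 2 * s + 1 \<or> y = 2 * s + 2"
      using theta_pair[OF n y] by metis
    \<comment> \<open>The partner of a smaller element is never a smaller element itself.\<close>
    have "z (l ! r) \<noteq> l ! s" "z (l ! s) \<noteq> l ! r"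
      using l_in[OF r(1)] l_in[OF s(1)] zz by (metis less_asym)+
    moreover have "z (l ! r) = z (l ! s) \<longleftrightarrow> l ! r = l ! s"
      using zz by metis
    ultimately show "x = y"
      using r(2) s(2) eq l_inj[OF r(1) s(1)] W1[OF r(1)] W1[OF s(1)] W2[OF r(1)] W2[OF s(1)]
      by (elim disjE) simp_all
  qed
  then have "bij_betw W {1..n} {1..n}"
    using W_in by (intro bij_betw_imageI endo_inj_surj) auto
  then have W: "W permutes {1..n}"
    by (rule bij_imp_permutes) (simp only: W_def if_False)
  have "z \<circ> W = W \<circ> theta n"
  proof
    fix y
    show "(z \<circ> W) y = (W \<circ> theta n) y"
    proof (cases "y \<in> {1..n}")
      case True
      show ?thesis
        by (rule theta_pair[OF n True]) (use W1 W2 zz in auto)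
    next
      case False
      then show ?thesis
        using permutes_not_in[OF z False] permutes_not_in[OF W False] permutes_not_in[OF theta_permutes[OF n] False]
        by simp
    qed
  qed
  then show ?thesis
    using that[of W] W W1 W2 l_in l_less by simp
qed

text \<open>The bottom element is left-justified with row lengths \<open>fpf_code\<close>, and the
  sorted labelling of \<open>z\<close> has the same Lehmer code; so the two permutations coincide
  and the intertwining follows.\<close>

lemma fpf_dream_fpf_bottom:
  assumes n: "even n" and z: "z \<in> fpf_involutions n"
  shows "fpf_dream n z (fpf_bottom n z)"
proof -
  have perm: "z permutes {1..n}" and fpf: "\<And>i. i \<in> {1..n} \<Longrightarrow> z i \<noteq> i"
    using z by (auto simp: fpf_involutions_def)
  have zz: "z (z x) = x" for x
    using z permutes_inverses(2)[OF perm, of x] by (simp add: fpf_involutions_def)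
  let ?c = "fpf_code n z" and ?E = "fpf_bottom n z"
  have bounds: "?c i < i" "i + ?c i \<le> n" if "i \<in> {1..n}" for i
    using fpf_code_bounds[OF perm that] by auto
  have E: "?E = {(i, k). i \<in> {1..n} \<and> 1 \<le> k \<and> k \<le> ?c i}"
    using bounds by (fastforce simp: fpf_bottom_def)
  have sub: "?E \<subseteq> strict_lower n" and tri: "\<forall>(i, j)\<in>?E. i + j \<le> n"
    using bounds by (fastforce simp: E strict_lower_def)+
  obtain W where W: "W permutes {1..n}" "z \<circ> W = W \<circ> theta n"
    "\<And>m. m < n div 2 \<Longrightarrow> W (2 * m + 1) < W (2 * m + 2)"
    "\<And>m m'. m < m' \<Longrightarrow> m' < n div 2 \<Longrightarrow> W (2 * m + 1) < W (2 * m' + 1)"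
    using fpf_involutions_sorted_labelling[OF n perm zz fpf] by metis
  have "dream_perm n ?E = W"
  proof (rule lehmer_inject[OF dream_perm_permutes[OF sub tri] W(1)])
    fix i assume i: "i \<in> {1..n}"
    show "lehmer (dream_perm n ?E) i = lehmer W i"
      using lehmer_dream_perm[OF bounds(2) E i] lehmer_eq_fpf_code[OF n W i] by simp
  qed
  moreover have "card ?E = (\<Sum>i\<in>{1..n}. ?c i)"
  proof -
    have "?E = (SIGMA i:{1..n}. {1..?c i})"
      by (auto simp: E)
    then show ?thesis
      by simp
  qed
  ultimately show ?thesis
    using sub tri W(2) card_inversions_involution[OF perm zz fpf] by (simp add: fpf_dream_def)
qed

section \<open>Chains of ladder moves\<close>

abbreviation ladder_move :: "pos set \<Rightarrow> pos set \<Rightarrow> bool" where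
  "ladder_move D E \<equiv> ladder_PD D E \<or> ladder_FD D E"

lemma le_FD_rtranclp: "le_FD = ladder_move\<^sup>*\<^sup>*"
  unfolding le_FD_def less_FD_def by (rule reflclp_tranclp)

lemma ladder_move_fpf_dream_iff:
  assumes "even n" "D \<subseteq> strict_lower n" "E \<subseteq> strict_lower n" "ladder_move D E"
  shows "fpf_dream n z D \<longleftrightarrow> fpf_dream n z E"
  using assms(4) ladder_PD_fpf_dream_iff[OF assms(1-3)] ladder_FD_fpf_dream_iff[OF assms(1-3)] by blast

text \<open>The sets inside a chain are not assumed to lie in \<open>strict_lower n\<close>, so its
  two conditions are tracked separately. This one passes from \<open>E\<close> to \<open>D\<close>:
  in the higher row \<open>i\<close>, \<open>E\<close> has a cell in column \<open>k + 1\<close> or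
  \<open>k\<close>, hence \<open>k < i < j\<close>.\<close>

lemma ladder_move_strict_lower_left:
  assumes "ladder_move D E" "E \<subseteq> {(i, k). 1 \<le> k \<and> k < i}"
  shows "D \<subseteq> {(i, k). 1 \<le> k \<and> k < i}"
  using assms(1)
proof
  assume "ladder_PD D E"
  then obtain i j k where "i < j" "E = D - {(j, k)} \<union> {(i, k + 1)}" "D \<subseteq> pos_quadrant"
    unfolding ladder_PD_def by blast
  moreover have "x \<in> E \<or> x = (j, k)" if "x \<in> D" for x
    using that calculation by auto
  moreover have "(i, k + 1) \<in> E"
    using calculation by auto
  ultimately show ?thesis
    using assms(2) by (fastforce simp: pos_quadrant_def)
next
  assume "ladder_FD D E"
  then obtain i j k where "i < j" "E = D - {(j, k)} \<union> {(i, k - 1)}" "D \<subseteq> pos_quadrant" "(i, k) \<in> D"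
    unfolding ladder_FD_def by blast
  moreover have "x \<in> E \<or> x = (j, k)" if "x \<in> D" for x
    using that calculation by auto
  moreover have "(i, k) \<in> E"
    using calculation by auto
  ultimately show ?thesis
    using assms(2) by (fastforce simp: pos_quadrant_def)
qed

text \<open>The other condition passes from \<open>D\<close> to \<open>E\<close>, since both moves
  raise a cell.\<close>

lemma ladder_move_rows:
  assumes "ladder_move D E" "D \<subseteq> {(i, k). i \<le> n}"
  shows "E \<subseteq> {(i, k). i \<le> n}"
proof -
  obtain i j k l where "i < j" "(j, k) \<in> D" "E = D - {(j, k)} \<union> {(i, l)}"
    using assms(1) unfolding ladder_PD_def ladder_FD_def by blast
  then show ?thesis
    using assms(2) by force
qed

lemma strict_lower_eq: "strict_lower n = {(i, k). 1 \<le> k \<and> k < i} \<inter> {(i, k). i \<le> n}"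
  by (auto simp: strict_lower_def)

text \<open>The row bound travels forward from \<open>D\<close> and the diagonal bound backward from
  \<open>E\<close>; the induction therefore proves the former and carries the latter as a
  premise.\<close>

lemma fpf_dream_ladder_chain_up:
  assumes "even n" "fpf_dream n z D" "ladder_move\<^sup>*\<^sup>* D E" "E \<subseteq> strict_lower n"
  shows "fpf_dream n z E"
proof -
  have "E \<subseteq> {(i, k). i \<le> n} \<and> (E \<subseteq> {(i, k). 1 \<le> k \<and> k < i} \<longrightarrow> fpf_dream n z E)"
    using assms(3)
  proof (induction rule: rtranclp_induct)
    case base
    then show ?case
      using assms(2) by (auto simp: fpf_dream_def strict_lower_eq)
  next
    case (step X Y)
    then show ?case
      using ladder_move_rows[OF step(2)] ladder_move_strict_lower_left[OF step(2)]
        ladder_move_fpf_dream_iff[OF assms(1) _ _ step(2), of z] by (simp add: strict_lower_eq)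
  qed
  then show ?thesis
    using assms(4) by (simp add: strict_lower_eq)
qed

text \<open>As for the upward chain, with the roles of the two bounds exchanged.\<close>

lemma fpf_dream_ladder_chain_down:
  assumes "even n" "fpf_dream n z E" "ladder_move\<^sup>*\<^sup>* D E" "D \<subseteq> strict_lower n"
  shows "fpf_dream n z D"
proof -
  have "D \<subseteq> {(i, k). 1 \<le> k \<and> k < i} \<and> (D \<subseteq> {(i, k). i \<le> n} \<longrightarrow> fpf_dream n z D)"
    using assms(3)
  proof (induction rule: converse_rtranclp_induct)
    case base
    then show ?case
      using assms(2) by (auto simp: fpf_dream_def strict_lower_eq)
  next
    case (step X Y)
    then show ?case
      using ladder_move_rows[OF step(1)] ladder_move_strict_lower_left[OF step(1)]
        ladder_move_fpf_dream_iff[OF assms(1) _ _ step(1), of z] by (simp add: strict_lower_eq)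
  qed
  then show ?thesis
    using assms(4) by (simp add: strict_lower_eq)
qed

text \<open>The case distinction of the overview. It also records that the cell moves down, to a row
  at most \<open>n\<close>, which makes the repetition of such moves terminate.\<close>

lemma fpf_dream_eq_bottom_or_inverse_ladder:
  assumes n: "even n" and E: "fpf_dream n z E"
  shows "E = fpf_bottom n z \<or> (\<exists>x y. x \<in> E \<and> y \<notin> E \<and> fst x < fst y \<and> fst y \<le> n \<and>
    insert y (E - {x}) \<subseteq> strict_lower n \<and> ladder_move (insert y (E - {x})) E)"
proof (cases "\<forall>i k. 1 \<le> k \<longrightarrow> (i, k + 1) \<in> E \<longrightarrow> (i, k) \<in> E")
  case False
  then obtain i k where "1 \<le> k" "(i, k + 1) \<in> E" "(i, k) \<notin> E"
    by blast
  from fpf_dream_inverse_ladder_PD[OF n E this(2,3,1)] show ?thesis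
    by (metis fst_conv)
next
  case True
  obtain c where c: "E = {(i, k). i \<in> {1..n} \<and> 1 \<le> k \<and> k \<le> c i}"
    "\<And>i. i \<in> {1..n} \<Longrightarrow> i + c i \<le> n"
  proof (rule left_justified_code[OF E])
    show "(i, k) \<in> E" if "1 \<le> k" "(i, k + 1) \<in> E" for i k
      using True that by simp
  qed (rule that; assumption)
  let ?W = "dream_perm n E"
  show ?thesis
  proof (cases "\<exists>m. 1 \<le> m \<and> m < n div 2 \<and> ?W (2 * m + 1) < ?W (2 * m - 1)")
    case True
    then obtain m where m: "1 \<le> m" "m < n div 2" "?W (2 * m + 1) < ?W (2 * m - 1)"
      by (elim exE conjE)
    have "\<exists>i j k. i < j \<and> j \<le> n \<and> (i, k - 1) \<in> E \<and> (j, k) \<notin> E \<and>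
        insert (j, k) (E - {(i, k - 1)}) \<subseteq> strict_lower n \<and>
        ladder_FD (insert (j, k) (E - {(i, k - 1)})) E"
      by (rule fpf_dream_inverse_ladder_FD[OF n E c(1) _ m]) (rule c(2))
    then obtain i j k where "i < j \<and> j \<le> n \<and> (i, k - 1) \<in> E \<and> (j, k) \<notin> E \<and>
        insert (j, k) (E - {(i, k - 1)}) \<subseteq> strict_lower n \<and>
        ladder_FD (insert (j, k) (E - {(i, k - 1)})) E"
      by (elim exE)
    then show ?thesis
      by (intro disjI2 exI[of _ "(i, k - 1)"] exI[of _ "(j, k)"]) simp
  next
    case False
    have W: "?W permutes {1..n}" "z \<circ> ?W = ?W \<circ> theta n"
      using E dream_perm_permutes[of E n] by (auto simp: fpf_dream_def)
    have pair: "?W (2 * m + 1) < ?W (2 * m + 2)" if "m < n div 2" for m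
      using fpf_dream_pair_less[OF n E, of "2 * m + 1"] that n by (auto elim!: evenE)
    have step: "?W (2 * m + 1) < ?W (2 * Suc m + 1)" if "Suc m < n div 2" for m
    proof -
      have "\<not> ?W (2 * Suc m + 1) < ?W (2 * Suc m - 1)"
        using False that by (metis le_add1 plus_1_eq_Suc)
      moreover have "2 * Suc m - 1 = 2 * m + 1" "2 * m + 1 \<noteq> 2 * Suc m + 1"
        by auto
      ultimately show ?thesis
        using injD[OF permutes_inj[OF W(1)]] by (metis linorder_neqE_nat)
    qed
    have sorted: "?W (2 * m + 1) < ?W (2 * m' + 1)" if "m < m'" "m' < n div 2" for m m'
      using that
    proof (induction m')
      case (Suc m')
      then show ?case
        using step[of m'] by (cases "m = m'") auto
    qed simp
    have "c i = fpf_code n z i" if "i \<in> {1..n}" for i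
      using lehmer_dream_perm[OF c(2,1) that] lehmer_eq_fpf_code[OF n W pair sorted that] by simp
    moreover have "c i \<le> n" if "i \<in> {1..n}" for i
      using c(2)[OF that] by simp
    ultimately have "E = fpf_bottom n z"
      unfolding fpf_bottom_def by (subst c(1)) fastforce
    then show ?thesis ..
  qed
qed

text \<open>Each inverse move lowers a cell and so decreases the sum of \<open>n - fst x\<close>,
  until the bottom element is reached.\<close>

lemma fpf_dream_bottom_le:
  assumes n: "even n" and E: "fpf_dream n z E"
  shows "ladder_move\<^sup>*\<^sup>* (fpf_bottom n z) E"
  using E
proof (induction "\<Sum>x\<in>E. n - fst x" arbitrary: E rule: less_induct)
  case less
  show ?case
    using fpf_dream_eq_bottom_or_inverse_ladder[OF n less.prems]
  proof
    assume "\<exists>x y. x \<in> E \<and> y \<notin> E \<and> fst x < fst y \<and> fst y \<le> n \<and>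
      insert y (E - {x}) \<subseteq> strict_lower n \<and> ladder_move (insert y (E - {x})) E"
    then obtain x y where xy: "x \<in> E" "y \<notin> E" "fst x < fst y" "fst y \<le> n"
      and D: "insert y (E - {x}) \<subseteq> strict_lower n" and move: "ladder_move (insert y (E - {x})) E"
      by blast
    have E: "E \<subseteq> strict_lower n"
      using less.prems by (simp add: fpf_dream_def)
    then have fin: "finite E"
      by (rule finite_subset) simp
    have "(\<Sum>x\<in>insert y (E - {x}). n - fst x) < (\<Sum>x\<in>E. n - fst x)"
      using fin xy by (simp add: sum.remove[of E x])
    moreover have "fpf_dream n z (insert y (E - {x}))"
      using ladder_move_fpf_dream_iff[OF n D E move] less.prems by blast
    ultimately have "ladder_move\<^sup>*\<^sup>* (fpf_bottom n z) (insert y (E - {x}))"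
      by (rule less.hyps)
    with move show ?case
      by (rule rtranclp.rtrancl_into_rtrancl[rotated])
  qed simp
qed

section \<open>Wiring diagrams as sweeps\<close>

lemma pipe_strand: "e \<in> pipe n D p \<Longrightarrow> strand n D e e' \<Longrightarrow> e' \<in> pipe n D p"
  unfolding pipe_def by (auto intro: rtranclp.rtrancl_into_rtrancl)

lemma strand_inj: "strand n D e e' \<Longrightarrow> strand n D f e' \<Longrightarrow> e = f"
  by (erule strand.cases; erule strand.cases; simp)

lemma strand_not_start: "\<not> strand n D e (Left_edge p 1)"
  by (rule notI, erule strand.cases; simp)

text \<open>Every edge has at most one predecessor and a left endpoint has none, so two pipes
  through a common edge agree back to their start.\<close>

lemma pipe_unique:
  assumes "e \<in> pipe n D p" "e \<in> pipe n D q"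
  shows "p = q"
proof -
  have "(strand n D)\<^sup>*\<^sup>* (Left_edge p 1) e" "(strand n D)\<^sup>*\<^sup>* (Left_edge q 1) e"
    using assms by (auto simp: pipe_def)
  then show ?thesis
  proof (induction rule: rtranclp_induct)
    case base
    then show ?case
      by (cases rule: rtranclp.cases) (use strand_not_start in auto)
  next
    case (step e e')
    from step.prems show ?case
    proof (cases rule: rtranclp.cases)
      case rtrancl_refl
      then show ?thesis
        using step.hyps(2) strand_not_start by metis
    next
      case (rtrancl_into_rtrancl b)
      then show ?thesis
        using step strand_inj by metis
    qed
  qed
qed

lemma crossings_unique:
  assumes "x \<in> crossings n D p q" "x \<in> crossings n D p' q'"
  shows "{p, q} = {p', q'}"
proof -
  obtain i j where x: "x = (i, j)"
    by (cases x)
  have "Left_edge i j \<in> pipe n D p \<and> Top_edge (i + 1) j \<in> pipe n D q \<or>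
     Left_edge i j \<in> pipe n D q \<and> Top_edge (i + 1) j \<in> pipe n D p"
    "Left_edge i j \<in> pipe n D p' \<and> Top_edge (i + 1) j \<in> pipe n D q' \<or>
     Left_edge i j \<in> pipe n D q' \<and> Top_edge (i + 1) j \<in> pipe n D p'"
    using assms by (auto simp: crossings_def x)
  then have "p = p' \<and> q = q' \<or> p = q' \<and> q = p'"
    by (elim disjE conjE) (use pipe_unique in blast)+
  then show ?thesis
    by auto
qed

text \<open>This includes the antidiagonal \<open>i + j = n + 1\<close>, whose cells hold a single
  turning path.\<close>

definition triangle :: "nat \<Rightarrow> pos set" where
  "triangle n = {(i, j). 1 \<le> i \<and> 1 \<le> j \<and> i + j \<le> Suc n}"

text \<open>\<open>swept n D S g\<close>: the cells of \<open>S\<close>, a set closed under going south-west, are read one after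
  another, and \<open>g\<close> sends each pipe to its position on the boundary of \<open>S\<close>, where the edges
  \<open>Left_edge i j\<close> and \<open>Top_edge i j\<close> have position \<open>i + j - 1\<close>.\<close>

inductive swept :: "nat \<Rightarrow> pos set \<Rightarrow> pos set \<Rightarrow> (nat \<Rightarrow> nat) \<Rightarrow> bool" for n D where
  empty: "swept n D {} id"
| step: "swept n D S g \<Longrightarrow> (i, j) \<in> triangle n \<Longrightarrow> (i, j) \<notin> S \<Longrightarrow>
    (\<And>i' j'. i \<le> i' \<Longrightarrow> j' \<le> j \<Longrightarrow> (i', j') \<in> triangle n \<Longrightarrow> (i', j') \<noteq> (i, j) \<Longrightarrow> (i', j') \<in> S) \<Longrightarrow>
    swept n D (insert (i, j) S) (if (i, j) \<in> D then adj (i + j - 1) \<circ> g else g)"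

lemma swept_subset: "swept n D S g \<Longrightarrow> S \<subseteq> triangle n \<and> finite S"
  by (induction rule: swept.induct) auto

lemma swept_closed:
  "swept n D S g \<Longrightarrow> (i, j) \<in> S \<Longrightarrow> i \<le> i' \<Longrightarrow> j' \<le> j \<Longrightarrow> (i', j') \<in> triangle n \<Longrightarrow> (i', j') \<in> S"
proof (induction arbitrary: i j rule: swept.induct)
  case (step S g k l)
  show ?case
  proof (cases "(i, j) = (k, l)")
    case True
    then show ?thesis
      using step.hyps(4)[of i' j'] step.prems by auto
  next
    case False
    then show ?thesis
      using step.IH[of i j] step.prems by auto
  qed
qed simp

text \<open>A bump joins left to top and bottom to right, edges of equal position, while a crossing
  exchanges the two positions at its cell. The case \<open>i = 0\<close> of the second part covers
  the top border of the diagram.\<close>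

lemma swept_edges:
  assumes D: "\<And>i j. (i, j) \<in> D \<Longrightarrow> i + j \<le> n" and "swept n D S g"
  shows "((i, j) \<in> triangle n \<longrightarrow> (i, j) \<notin> S \<longrightarrow> j = 1 \<or> (i, j - 1) \<in> S \<longrightarrow> g p = i + j - 1 \<longrightarrow>
      Left_edge i j \<in> pipe n D p) \<and>
    ((i + 1, j) \<in> S \<longrightarrow> (i, j) \<notin> S \<longrightarrow> g p = i + j \<longrightarrow> Top_edge (i + 1) j \<in> pipe n D p)"
  using assms(2)
proof (induction arbitrary: i j rule: swept.induct)
  case empty
  then show ?case
    by (auto simp: pipe_def)
next
  case (step S g k l)
  let ?g = "if (k, l) \<in> D then adj (k + l - 1) \<circ> g else g"
  have kl: "1 \<le> k" "1 \<le> l" "k + l \<le> Suc n"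
    using step.hyps(2) by (auto simp: triangle_def)
  have closed: "(i', j') \<in> S" if "(i, j) \<in> S" "i \<le> i'" "j' \<le> j" "1 \<le> i'" "1 \<le> j'" "i' + j' \<le> Suc n" for i j i' j'
    using swept_closed[OF step.hyps(1) that(1-3)] that(4-6) by (simp add: triangle_def)
  have before: "(i', j') \<in> S" if "k \<le> i'" "j' \<le> l" "1 \<le> j'" "i' + j' \<le> Suc n" "(i', j') \<noteq> (k, l)" for i' j'
    using step.hyps(4)[of i' j'] that kl by (simp add: triangle_def)
  have left: "Left_edge k l \<in> pipe n D p" if "g p = k + l - 1"
    using step.IH[of k l] step.hyps(2,3) that before[of k "l - 1"] kl by (cases "l = 1") auto
  have bottom: "Top_edge (k + 1) l \<in> pipe n D p" if "g p = k + l" "k + l \<le> n"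
    using step.IH[of k l] step.hyps(3) that before[of "k + 1" l] kl by auto
  show ?case
  proof (intro conjI impI)
    assume ij: "(i, j) \<in> triangle n" "(i, j) \<notin> insert (k, l) S" "j = 1 \<or> (i, j - 1) \<in> insert (k, l) S"
      and g: "?g p = i + j - 1"
    have ij': "1 \<le> i" "1 \<le> j" "i + j \<le> Suc n"
      using ij(1) by (auto simp: triangle_def)
    show "Left_edge i j \<in> pipe n D p"
    proof (cases "(i, j - 1) = (k, l)")
      case True
      then have eq: "i = k" "j = l + 1"
        using ij' kl by auto
      then have le: "k + l \<le> n"
        using ij' by simp
      show ?thesis
      proof (cases "(k, l) \<in> D")
        case True
        then have "g p = k + l - 1"
          using g eq kl by (auto simp: transpose_def split: if_splits)
        then show ?thesis
          using pipe_strand[OF left strand.cross_lr[OF kl(1,2) le True]] eq by simp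
      next
        case False
        then have "g p = k + l"
          using g eq by simp
        then show ?thesis
          using pipe_strand[OF bottom strand.bump_br[OF kl(1,2) le False]] eq le by simp
      qed
    next
      case False
      then have S: "j = 1 \<or> (i, j - 1) \<in> S"
        using ij(3) by auto
      \<comment> \<open>The boundary has one edge in each position, so an edge away from the new
        cell has neither of the two positions at that cell.\<close>
      have "i + j \<noteq> k + l"
      proof
        assume sum: "i + j = k + l"
        show False
        proof (cases "i < k")
          case True
          then have "(i, j - 1) \<in> S" "l \<le> j - 1"
            using S sum kl by auto
          then have "(k, l) \<in> S"
            using closed[of i "j - 1" k l] True kl by simp
          with step.hyps(3) show False ..
        next
          case False
          then have "(i, j) \<in> S"
            using before[of i j] sum ij ij' by auto
          with ij(2) show False by simp
        qed
      qed
      moreover have "i + j \<noteq> k + l + 1"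
      proof
        assume sum: "i + j = k + l + 1"
        show False
        proof (cases "i \<le> k")
          case True
          then have "(i, j - 1) \<in> S" "l \<le> j - 1"
            using S sum kl by auto
          then have "(k, l) \<in> S"
            using closed[of i "j - 1" k l] True kl by simp
          with step.hyps(3) show False ..
        next
          case False
          then have "(i, j) \<in> S"
            using before[of i j] sum ij ij' by auto
          with ij(2) show False by simp
        qed
      qed
      ultimately have "g p = i + j - 1"
        using g ij' kl by (auto simp: transpose_def split: if_splits)
      then show ?thesis
        using step.IH[of i j] ij S by blast
    qed
  next
    assume ij: "(i + 1, j) \<in> insert (k, l) S" "(i, j) \<notin> insert (k, l) S" and g: "?g p = i + j"
    have ij': "1 \<le> j" "i + j \<le> n"
      using ij(1) kl swept_subset[OF step.hyps(1)] by (auto simp: triangle_def)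
    show "Top_edge (i + 1) j \<in> pipe n D p"
    proof (cases "(i + 1, j) = (k, l)")
      case True
      then have eq: "k = i + 1" "l = j"
        by auto
      show ?thesis
      proof (cases "(k, l) \<in> D")
        case True
        then have "g p = k + l"
          using g eq kl by (auto simp: transpose_def split: if_splits)
        then show ?thesis
          using pipe_strand[OF bottom strand.cross_bt[OF kl(1,2) D[OF True] True]] eq D[OF True] by simp
      next
        case False
        then have "g p = k + l - 1"
          using g eq by simp
        moreover have "strand n D (Left_edge k l) (Top_edge k l)"
          using strand.bump_lt[OF kl(1,2) _ False] strand.diag_lt[OF kl(1,2)] kl(3)
          by (cases "k + l \<le> n") auto
        ultimately show ?thesis
          using pipe_strand[OF left] eq by simp
      qed
    next
      case False
      then have S: "(i + 1, j) \<in> S"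
        using ij(1) by auto
      have "i + j \<noteq> k + l"
      proof
        assume sum: "i + j = k + l"
        show False
        proof (cases "i < k")
          case True
          then have "(k, l) \<in> S"
            using closed[OF S, of k l] sum kl by simp
          with step.hyps(3) show False ..
        next
          case False
          then have "(i, j) \<in> S"
            using before[of i j] sum ij ij' by auto
          with ij(2) show False by simp
        qed
      qed
      moreover have "i + j \<noteq> k + l - 1"
      proof
        assume sum: "i + j = k + l - 1"
        show False
        proof (cases "i < k")
          case True
          then have "(k, l) \<in> S"
            using closed[OF S, of k l] sum kl by simp
          with step.hyps(3) show False ..
        next
          case False
          then have "k \<le> i" "j \<le> l" "i \<noteq> k \<or> j \<noteq> l"
            using sum kl(1,2) by linarith+
          then have "(i, j) \<in> S"
            using before[of i j] ij' by auto
          with ij(2) show False by simp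
        qed
      qed
      ultimately have "g p = i + j"
        using g kl by (auto simp: transpose_def split: if_splits)
      then show ?thesis
        using step.IH[of i j] ij S by blast
    qed
  qed
qed

lemma swept_permutes:
  assumes D: "\<And>i j. (i, j) \<in> D \<Longrightarrow> i + j \<le> n" and "swept n D S g"
  shows "g permutes {1..n}"
  using assms(2)
proof (induction rule: swept.induct)
  case (step S g i j)
  have "adj (i + j - 1) permutes {1..n}" if "(i, j) \<in> D"
    using D[OF that] step.hyps(2) by (intro adj_permutes) (auto simp: triangle_def)
  then show ?case
    using step.IH by (cases "(i, j) \<in> D") (simp_all add: permutes_compose del: o_apply)
qed (rule permutes_id)

text \<open>Reading a crossing of \<open>p\<close> and \<open>q\<close> exchanges their neighbouring
  positions and so flips both the parity and their order; a crossing of any other pair leaves both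
  unchanged.\<close>

lemma swept_crossings:
  assumes D: "\<And>i j. (i, j) \<in> D \<Longrightarrow> i + j \<le> n" and "swept n D S g"
  shows "(p < q \<longrightarrow> (odd (card (crossings n D p q \<inter> S)) \<longleftrightarrow> g q < g p)) \<and>
    (\<forall>x\<in>S \<inter> D. \<exists>p\<in>{1..n}. \<exists>q\<in>{1..n}. p < q \<and> x \<in> crossings n D p q)"
  using assms(2)
proof (induction rule: swept.induct)
  case (step S g i j)
  let ?a = "i + j - 1"
  let ?g = "if (i, j) \<in> D then adj ?a \<circ> g else g"
  have ij: "1 \<le> i" "1 \<le> j" "i + j \<le> Suc n"
    using step.hyps(2) by (auto simp: triangle_def)
  have fin: "finite S"
    using swept_subset[OF step.hyps(1)] by simp
  have g: "g permutes {1..n}"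
    by (rule swept_permutes[OF D step.hyps(1)])
  show ?case
  proof (cases "(i, j) \<in> D")
    case False
    then have "crossings n D p q \<inter> insert (i, j) S = crossings n D p q \<inter> S"
      by (auto simp: crossings_def)
    then show ?thesis
      using step.IH False by auto
  next
    case True
    have le: "i + j \<le> n"
      by (rule D[OF True])
    \<comment> \<open>The pipe in position \<open>?a\<close> runs through this edge, and no second
      pipe does.\<close>
    have left: "Left_edge i j \<in> pipe n D p \<longleftrightarrow> g p = ?a" for p
    proof -
      have "j = 1 \<or> (i, j - 1) \<in> S"
      proof (cases "j = 1")
        case False
        then have "j - 1 \<le> j" "(i, j - 1) \<in> triangle n" "(i, j - 1) \<noteq> (i, j)"
          using ij by (auto simp: triangle_def)
        then show ?thesis
          using step.hyps(4)[OF order_refl] by blast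
      qed simp
      then have "Left_edge i j \<in> pipe n D p" if "g p = ?a" for p
        using swept_edges[OF D step.hyps(1), of i j p] step.hyps(2,3) that by blast
      moreover have "g (inv g ?a) = ?a"
        by (rule permutes_inverses(1)[OF g])
      ultimately show ?thesis
        using pipe_unique by metis
    qed
    have bottom: "Top_edge (i + 1) j \<in> pipe n D p \<longleftrightarrow> g p = Suc ?a" for p
    proof -
      have "(i + 1, j) \<in> S"
        using step.hyps(4)[of "i + 1" j] ij le by (auto simp: triangle_def)
      then have "Top_edge (i + 1) j \<in> pipe n D p" if "g p = Suc ?a" for p
        using swept_edges[OF D step.hyps(1), of i j p] step.hyps(3) that ij by auto
      moreover have "g (inv g (Suc ?a)) = Suc ?a"
        by (rule permutes_inverses(1)[OF g])
      ultimately show ?thesis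
        using pipe_unique by metis
    qed
    have cross: "(i, j) \<in> crossings n D p q \<longleftrightarrow> {g p, g q} = {?a, Suc ?a}" for p q
      using True left bottom by (auto simp: crossings_def doubleton_eq_iff)
    show ?thesis
    proof (intro conjI impI ballI)
      assume "p < q"
      then have ne: "g p \<noteq> g q"
        using injD[OF permutes_inj[OF g], of p q] by auto
      have IH: "odd (card (crossings n D p q \<inter> S)) \<longleftrightarrow> g q < g p"
        using step.IH \<open>p < q\<close> by blast
      show "odd (card (crossings n D p q \<inter> insert (i, j) S)) \<longleftrightarrow> ?g q < ?g p"
      proof (cases "(i, j) \<in> crossings n D p q")
        case c: True
        then have "crossings n D p q \<inter> insert (i, j) S = insert (i, j) (crossings n D p q \<inter> S)"
          by auto
        then have "odd (card (crossings n D p q \<inter> insert (i, j) S)) \<longleftrightarrow> \<not> g q < g p"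
          using fin step.hyps(3) IH by simp
        also have "\<dots> \<longleftrightarrow> ?g q < ?g p"
          using c True unfolding cross by (auto simp: doubleton_eq_iff)
        finally show ?thesis .
      next
        case c: False
        then have "crossings n D p q \<inter> insert (i, j) S = crossings n D p q \<inter> S"
          by auto
        moreover have "?g q < ?g p \<longleftrightarrow> g q < g p"
          using c True ne unfolding cross by (auto simp: transpose_def)
        ultimately show ?thesis
          using IH by simp
      qed
    next
      fix x assume x: "x \<in> insert (i, j) S \<inter> D"
      show "\<exists>p\<in>{1..n}. \<exists>q\<in>{1..n}. p < q \<and> x \<in> crossings n D p q"
      proof (cases "x = (i, j)")
        case True
        define u v where "u = inv g ?a" and "v = inv g (Suc ?a)"
        have uv: "g u = ?a" "g v = Suc ?a"
          by (simp_all only: u_def v_def permutes_inverses(1)[OF g])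
        then have "u \<in> {1..n}" "v \<in> {1..n}" "u \<noteq> v"
          using permutes_in_image[OF g, of u] permutes_in_image[OF g, of v] ij le by auto
        moreover have "x \<in> crossings n D u v" "x \<in> crossings n D v u"
          unfolding True cross using uv by auto
        ultimately show ?thesis
          by (metis linorder_neqE_nat)
      next
        case False
        then show ?thesis
          using step.IH x by blast
      qed
    qed
  qed
qed simp

text \<open>Each crossing belongs to one pair of pipes, so \<open>card D\<close> is the sum of the
  crossing numbers of the pairs, while the inversions of \<open>g\<close> are counted by their
  parities. The two sums agree exactly if no pair crosses more than once.\<close>

lemma PD_iff_swept:
  assumes D: "D \<subseteq> {(i, j). i \<in> {1..n} \<and> j \<in> {1..n} \<and> i + j \<le> n}"
    and w: "w permutes {1..n}" and sw: "swept n D (triangle n) g"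
  shows "D \<in> PD n w \<longleftrightarrow> w = g \<and> card D = card (inversions n w)"
proof -
  have D': "i + j \<le> n" if "(i, j) \<in> D" for i j
    using D that by auto
  have D_tri: "D \<subseteq> triangle n"
    using D by (auto simp: triangle_def)
  have finD: "finite D"
    using D_tri swept_subset[OF sw] finite_subset by blast
  have g: "g permutes {1..n}"
    by (rule swept_permutes[OF D' sw])
  have top: "Top_edge 1 (g p) \<in> pipe n D p" if "p \<in> {1..n}" for p
  proof -
    have "g p \<in> {1..n}"
      using permutes_in_image[OF g] that by blast
    then show ?thesis
      using swept_edges[OF D' sw, of 0 "g p" p] by (auto simp: triangle_def)
  qed
  have ends: "(\<forall>i\<in>{1..n}. Top_edge 1 (w i) \<in> pipe n D i) \<longleftrightarrow> w = g"
  proof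
    assume *: "\<forall>i\<in>{1..n}. Top_edge 1 (w i) \<in> pipe n D i"
    show "w = g"
    proof
      fix i
      show "w i = g i"
      proof (cases "i \<in> {1..n}")
        case True
        let ?q = "inv g (w i)"
        have gq: "g ?q = w i"
          by (rule permutes_inverses(1)[OF g])
        have "w i \<in> {1..n}"
          using permutes_in_image[OF w] True by blast
        then have "?q \<in> {1..n}"
          using permutes_in_image[OF g, of ?q] gq by simp
        from top[OF this] have "Top_edge 1 (w i) \<in> pipe n D ?q"
          unfolding gq .
        then have "?q = i"
          using * True pipe_unique by blast
        then show ?thesis
          using gq by simp
      next
        case False
        then show ?thesis
          using permutes_not_in[OF w] permutes_not_in[OF g] by simp
      qed
    qed
  qed (use top in simp)
  define P where "P = {(p, q). 1 \<le> p \<and> p < q \<and> q \<le> n}"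
  have finP: "finite P"
    by (rule finite_subset[of _ "{1..n} \<times> {1..n}"]) (auto simp: P_def)
  let ?cr = "\<lambda>(p, q). crossings n D p q"
  have fin_cr: "finite (crossings n D p q)" for p q
    by (rule finite_subset[OF _ finD]) (auto simp: crossings_def)
  have "D = (\<Union>x\<in>P. ?cr x)"
  proof (intro equalityI subsetI)
    fix x assume "x \<in> D"
    then have "x \<in> triangle n \<inter> D"
      using D_tri by auto
    then obtain p q where "p \<in> {1..n}" "q \<in> {1..n}" "p < q" "x \<in> crossings n D p q"
      using swept_crossings[OF D' sw] by blast
    then show "x \<in> (\<Union>x\<in>P. ?cr x)"
      by (auto simp: P_def intro!: bexI[of _ "(p, q)"])
  qed (auto simp: crossings_def)
  moreover have "card (\<Union>x\<in>P. ?cr x) = (\<Sum>x\<in>P. card (?cr x))"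
  proof (rule card_UN_disjoint)
    show "\<forall>x\<in>P. \<forall>y\<in>P. x \<noteq> y \<longrightarrow> ?cr x \<inter> ?cr y = {}"
    proof (intro ballI impI)
      fix x y assume "x \<in> P" "y \<in> P" "x \<noteq> y"
      then show "?cr x \<inter> ?cr y = {}"
        by (cases x; cases y) (auto simp: P_def doubleton_eq_iff dest: crossings_unique)
    qed
  qed (use finP fin_cr in auto)
  ultimately have cardD: "card D = (\<Sum>x\<in>P. card (?cr x))"
    by simp
  have inv: "card (inversions n g) = (\<Sum>x\<in>P. card (?cr x) mod 2)"
  proof -
    have "crossings n D p q \<inter> triangle n = crossings n D p q" for p q
      using D_tri by (auto simp: crossings_def)
    then have "odd (card (crossings n D p q)) \<longleftrightarrow> g q < g p" if "p < q" for p q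
      using swept_crossings[OF D' sw, of p q] that by simp
    then have "inversions n g = {x \<in> P. odd (card (?cr x))}"
      by (auto simp: inversions_def P_def)
    then have "card (inversions n g) = (\<Sum>x\<in>P. if odd (card (?cr x)) then 1 else 0)"
      using finP by (simp add: sum.If_cases Int_def)
    also have "\<dots> = (\<Sum>x\<in>P. card (?cr x) mod 2)"
      by (intro sum.cong refl) (simp add: odd_iff_mod_2_eq_one)
    finally show ?thesis .
  qed
  have comm: "crossings n D p q = crossings n D q p" for p q
    by (auto simp: crossings_def)
  have "reduced_pipe_dream n D \<longleftrightarrow> (\<forall>x\<in>P. card (?cr x) \<le> 1)"
  proof
    assume red: "\<forall>x\<in>P. card (?cr x) \<le> 1"
    show "reduced_pipe_dream n D"
      unfolding reduced_pipe_dream_def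
    proof (intro conjI D ballI impI)
      fix p q assume "p \<in> {1..n}" "q \<in> {1..n}" "p \<noteq> q"
      then have "(p, q) \<in> P \<or> (q, p) \<in> P"
        by (auto simp: P_def)
      then show "card (crossings n D p q) \<le> 1"
        using red comm[of p q] by auto
    qed
  qed (auto simp: reduced_pipe_dream_def P_def)
  also have "\<dots> \<longleftrightarrow> card D = card (inversions n g)"
  proof
    assume "\<forall>x\<in>P. card (?cr x) \<le> 1"
    then have "card (?cr x) mod 2 = card (?cr x)" if "x \<in> P" for x
      using that by (intro mod_less) force
    then show "card D = card (inversions n g)"
      unfolding cardD inv by simp
  next
    assume "card D = card (inversions n g)"
    then have eq: "(\<Sum>x\<in>P. card (?cr x) mod 2) = (\<Sum>x\<in>P. card (?cr x))"
      unfolding cardD inv by simp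
    show "\<forall>x\<in>P. card (?cr x) \<le> 1"
    proof
      fix x assume "x \<in> P"
      \<comment> \<open>A number is at least its remainder mod 2, so equal sums force equality in
        every term.\<close>
      from sum_mono_inv[OF eq _ this finP] have "card (?cr x) mod 2 = card (?cr x)"
        by simp
      moreover have "card (?cr x) mod 2 < 2"
        by simp
      ultimately show "card (?cr x) \<le> 1"
        by linarith
    qed
  qed
  finally have reduced: "reduced_pipe_dream n D \<longleftrightarrow> card D = card (inversions n g)" .
  show ?thesis
    unfolding PD_def mem_Collect_eq ends reduced by auto
qed

section \<open>Symmetric pipe dreams\<close>

text \<open>Letters are listed in the order of reading and each new one is composed on the left;
  hence the reversal.\<close>

lemma swept_step:
  assumes "swept n D S (word_perm (rev us))" "(i, j) \<in> triangle n" "(i, j) \<notin> S"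
    and "\<And>i' j'. i \<le> i' \<Longrightarrow> j' \<le> j \<Longrightarrow> (i', j') \<in> triangle n \<Longrightarrow> (i', j') \<noteq> (i, j) \<Longrightarrow> (i', j') \<in> S"
    and "S' = insert (i, j) S" "vs = us @ (if (i, j) \<in> D then [i + j - 1] else [])"
  shows "swept n D S' (word_perm (rev vs))"
  using swept.step[OF assms(1-4)] by (simp add: assms(5,6) split: if_splits del: o_apply)

lemma col_word_Suc: "l \<le> m \<Longrightarrow> col_word E i l (Suc m) = col_word E i l m @ (if (i, m) \<in> E then [i + m - 1] else [])"
  by (simp add: col_word_def)

lemma col_word_Cons: "l < m \<Longrightarrow> col_word E i l m = (if (i, l) \<in> E then [i + l - 1] else []) @ col_word E i (Suc l) m"
  by (simp add: col_word_def upt_conv_Cons)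

lemma col_word_empty: "(\<And>j. l \<le> j \<Longrightarrow> j < m \<Longrightarrow> (i, j) \<notin> E) \<Longrightarrow> col_word E i l m = []"
  by (auto simp: col_word_def filter_empty_conv)

definition diag_word :: "pos set \<Rightarrow> nat \<Rightarrow> nat list" where
  "diag_word D d = map (\<lambda>e. 2 * e - 1) (filter (\<lambda>e. (e, e) \<in> D) [1..<Suc d])"

lemma diag_word_Suc: "diag_word D (Suc d) = diag_word D d @ (if (Suc d, Suc d) \<in> D then [2 * d + 1] else [])"
  by (simp add: diag_word_def)

text \<open>The lower half is read row by row, then the diagonal, then the mirror image of the lower half
  in reverse order.\<close>

context
  fixes n :: nat and D :: "pos set"
  assumes n: "even n" and sub: "D \<subseteq> {(i, j). i \<in> {1..n} \<and> j \<in> {1..n} \<and> i + j \<le> n}"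
    and sym_D: "sym D"
  notes o_apply [simp del] and id_apply [simp del]
begin

private abbreviation E where "E \<equiv> D \<inter> strict_lower n"

private definition lower :: "pos set" where
  "lower = {(r, c) \<in> triangle n. c < r}"

private lemma E_iff: "c < r \<Longrightarrow> (r, c) \<in> E \<longleftrightarrow> (r, c) \<in> D"
  using sub by (auto simp: strict_lower_def)

private lemma E_empty: "(r, c) \<notin> E" if "r \<le> c \<or> n < r + c"
  using that sub by (auto simp: strict_lower_def)

private lemma swept_lower_row:
  assumes i: "1 \<le> i" "i \<le> n"
    and prev: "swept n D {(r, c) \<in> lower. i < r} (word_perm (rev (rows_word n E (Suc i) (Suc n))))"
  shows "swept n D {(r, c) \<in> lower. i \<le> r} (word_perm (rev (rows_word n E i (Suc n))))"
proof -
  let ?S = "\<lambda>j. {(r, c) \<in> lower. i < r \<or> r = i \<and> c \<le> j}"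
  \<comment> \<open>The number of cells of \<open>lower\<close> in row \<open>i\<close>.\<close>
  define J where "J = min (i - 1) (Suc n - i)"
  have "swept n D (?S j) (word_perm (rev (rows_word n E (Suc i) (Suc n) @ col_word E i 1 (Suc j))))"
    if "j \<le> J" for j
    using that
  proof (induction j)
    case 0
    have "?S 0 = {(r, c) \<in> lower. i < r}"
      by (auto simp: lower_def triangle_def)
    then show ?case
      using prev by (simp add: col_word_def)
  next
    case (Suc j)
    then have j: "Suc j < i" "i + Suc j \<le> Suc n"
      using i by (auto simp: J_def)
    have IH: "swept n D (?S j) (word_perm (rev (rows_word n E (Suc i) (Suc n) @ col_word E i 1 (Suc j))))"
      using Suc by simp
    show ?case
    proof (rule swept_step[OF IH, of i "Suc j"])
      show "?S (Suc j) = insert (i, Suc j) (?S j)"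
        using j i by (auto simp: lower_def triangle_def)
      show "rows_word n E (Suc i) (Suc n) @ col_word E i 1 (Suc (Suc j)) =
          (rows_word n E (Suc i) (Suc n) @ col_word E i 1 (Suc j)) @
          (if (i, Suc j) \<in> D then [i + Suc j - 1] else [])"
        using col_word_Suc[of 1 "Suc j" E i] E_iff[OF j(1)] by simp
    qed (use j i in \<open>auto simp: lower_def triangle_def\<close>)
  qed
  from this[of J] have "swept n D (?S J) (word_perm (rev (rows_word n E (Suc i) (Suc n) @ col_word E i 1 (Suc J))))"
    by simp
  moreover have "?S J = {(r, c) \<in> lower. i \<le> r}"
    by (auto simp: J_def lower_def triangle_def)
  moreover have "col_word E i 1 (Suc n) = col_word E i 1 (Suc J)"
  proof -
    have "[1..<Suc n] = [1..<Suc J] @ [Suc J..<Suc n]"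
      using upt_add_eq_append[of 1 "Suc J" "n - J"] i by (simp add: J_def)
    moreover have "col_word E i (Suc J) (Suc n) = []"
      by (rule col_word_empty, rule E_empty) (auto simp: J_def)
    ultimately show ?thesis
      by (simp add: col_word_def del: upt_Suc)
  qed
  moreover have "rows_word n E i (Suc n) = rows_word n E (Suc i) (Suc n) @ col_word E i 1 (Suc n)"
    using rows_word_split[of i "Suc i" "Suc n" n E] i by (simp add: rows_word_Suc)
  ultimately show ?thesis
    by simp
qed

private lemma swept_lower:
  "swept n D lower (word_perm (rev (rows_word n E 1 (Suc n))))"
proof -
  have "swept n D {(r, c) \<in> lower. i < r} (word_perm (rev (rows_word n E (Suc i) (Suc n))))" if "i \<le> n" for i
    using that
  proof (induction i rule: inc_induct)
    case base
    have "{(r, c) \<in> lower. n < r} = {}"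
      by (auto simp: lower_def triangle_def)
    then show ?case
      using swept.empty by (simp only: rows_word_empty rev.simps word_perm_Nil)
  next
    case (step i)
    from swept_lower_row[OF _ _ step.IH] step.hyps show ?case
      by (simp add: Suc_le_eq)
  qed
  from this[of 0] have "swept n D {(r, c) \<in> lower. 0 < r} (word_perm (rev (rows_word n E 1 (Suc n))))"
    by simp
  moreover have "{(r, c) \<in> lower. 0 < r} = lower"
    by (auto simp: lower_def triangle_def)
  ultimately show ?thesis
    by simp
qed

private lemma swept_diag:
  "d \<le> n div 2 \<Longrightarrow> swept n D (lower \<union> {(e, e) | e. 1 \<le> e \<and> e \<le> d})
    (word_perm (rev (rows_word n E 1 (Suc n) @ diag_word D d)))"
proof (induction d)
  case 0
  have "lower \<union> {(e, e) | e. 1 \<le> e \<and> e \<le> (0::nat)} = lower"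
    by auto
  then show ?case
    using swept_lower by (simp add: diag_word_def)
next
  case (Suc d)
  then have IH: "swept n D (lower \<union> {(e, e) | e. 1 \<le> e \<and> e \<le> d})
    (word_perm (rev (rows_word n E 1 (Suc n) @ diag_word D d)))"
    by simp
  show ?case
  proof (rule swept_step[OF IH, of "Suc d" "Suc d"])
    show "(Suc d, Suc d) \<in> triangle n"
      using Suc.prems by (auto simp: triangle_def)
    show "rows_word n E 1 (Suc n) @ diag_word D (Suc d) = (rows_word n E 1 (Suc n) @ diag_word D d) @
        (if (Suc d, Suc d) \<in> D then [Suc d + Suc d - 1] else [])"
      by (simp add: diag_word_Suc mult_2)
  qed (auto simp: lower_def)
qed

private abbreviation half_word :: "nat list" where
  "half_word \<equiv> rows_word n E 1 (Suc n) @ diag_word D (n div 2)"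

private lemma swept_upper_row:
  assumes i: "1 \<le> i" "i \<le> n"
    and prev: "swept n D {(r, c) \<in> triangle n. c \<le> r \<or> c < i} (word_perm (rev (half_word @ rev (rows_word n E 1 i))))"
  shows "swept n D {(r, c) \<in> triangle n. c \<le> r \<or> c \<le> i} (word_perm (rev (half_word @ rev (rows_word n E 1 (Suc i)))))"
proof -
  let ?S = "\<lambda>j. {(r, c) \<in> triangle n. c \<le> r \<or> c < i \<or> c = i \<and> j < r}"
  \<comment> \<open>The number of cells above the diagonal in column \<open>i\<close>; they are read
    upwards, which reverses the order of the mirrored row.\<close>
  define J where "J = min (i - 1) (Suc n - i)"
  have "swept n D (?S j) (word_perm (rev (half_word @ rev (col_word E i (Suc j) (Suc n) @ rows_word n E 1 i))))"
    if "j \<le> J" for j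
    using that
  proof (induction j rule: inc_induct)
    case base
    have "?S J = {(r, c) \<in> triangle n. c \<le> r \<or> c < i}"
      by (auto simp: J_def triangle_def)
    moreover have "col_word E i (Suc J) (Suc n) = []"
      by (rule col_word_empty, rule E_empty) (auto simp: J_def)
    ultimately show ?case
      using prev by simp
  next
    case (step j)
    then have j: "Suc j < i" "i + Suc j \<le> Suc n"
      using i by (auto simp: J_def)
    show ?case
    proof (rule swept_step[OF step.IH, of "Suc j" i])
      show "?S j = insert (Suc j, i) (?S (Suc j))"
        using j i by (auto simp: triangle_def)
      have "(Suc j, i) \<in> D \<longleftrightarrow> (i, Suc j) \<in> E"
        using E_iff[OF j(1)] sym_D by (auto dest: symD)
      then show "half_word @ rev (col_word E i (Suc j) (Suc n) @ rows_word n E 1 i) =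
          (half_word @ rev (col_word E i (Suc (Suc j)) (Suc n) @ rows_word n E 1 i)) @
          (if (Suc j, i) \<in> D then [Suc j + i - 1] else [])"
        using col_word_Cons[of "Suc j" "Suc n" E i] j i by (simp add: add.commute)
    qed (use j i in \<open>auto simp: triangle_def\<close>)
  qed
  from this[of 0] have "swept n D (?S 0) (word_perm (rev (half_word @ rev (col_word E i 1 (Suc n) @ rows_word n E 1 i))))"
    by simp
  moreover have "?S 0 = {(r, c) \<in> triangle n. c \<le> r \<or> c \<le> i}"
    by (auto simp: triangle_def)
  ultimately show ?thesis
    using i by (simp add: rows_word_Suc)
qed

text \<open>If \<open>u\<close> is the word of the lower half, the whole reading is
  \<open>u\<close>, then the diagonal letters, then \<open>rev u\<close>. Reversing it for
  \<open>word_perm\<close> puts \<open>W\<close> on the left and its inverse on the right.\<close>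

lemma swept_symmetric:
  defines "W \<equiv> dream_perm n (D \<inter> strict_lower n)"
  shows "swept n D (triangle n) (W \<circ> (word_perm (rev (diag_word D (n div 2))) \<circ> inv W))"
proof -
  have upper: "swept n D {(r, c) \<in> triangle n. c \<le> r \<or> c \<le> i} (word_perm (rev (half_word @ rev (rows_word n E 1 (Suc i)))))"
    if "i \<le> n" for i
    using that
  proof (induction i)
    case 0
    \<comment> \<open>For even \<open>n\<close> the diagonal of the triangle consists of the first
      \<open>n div 2\<close> cells.\<close>
    have "lower \<union> {(e, e) | e. 1 \<le> e \<and> e \<le> n div 2} = {(r, c) \<in> triangle n. c \<le> r \<or> c \<le> 0}"
      using n by (auto simp: lower_def triangle_def elim!: evenE)
    then show ?case
      using swept_diag[of "n div 2"] by simp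
  next
    case (Suc i)
    have "{(r, c) \<in> triangle n. c \<le> r \<or> c < Suc i} = {(r, c) \<in> triangle n. c \<le> r \<or> c \<le> i}"
      by auto
    then show ?case
      using swept_upper_row[of "Suc i"] Suc by simp
  qed
  have "{(r, c) \<in> triangle n. c \<le> r \<or> c \<le> n} = triangle n"
    by (auto simp: triangle_def)
  with upper[of n] have "swept n D (triangle n) (word_perm (rev (half_word @ rev (rows_word n E 1 (Suc n)))))"
    by simp
  moreover have "word_perm (rev (rows_word n E 1 (Suc n))) = inv W"
  proof -
    have "word_perm us \<circ> word_perm (rev us) = id \<and> word_perm (rev us) \<circ> word_perm us = id" for us
    proof (induction us)
      case (Cons a us)
      have "word_perm (a # us) \<circ> word_perm (rev (a # us)) = adj a \<circ> ((word_perm us \<circ> word_perm (rev us)) \<circ> adj a)"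
        "word_perm (rev (a # us)) \<circ> word_perm (a # us) = word_perm (rev us) \<circ> ((adj a \<circ> adj a) \<circ> word_perm us)"
        by (simp_all add: comp_assoc)
      with Cons show ?case
        by (simp del: o_apply)
    qed simp
    then show ?thesis
      unfolding W_def by (intro inv_unique_comp[symmetric]) auto
  qed
  ultimately show ?thesis
    by (simp add: W_def comp_assoc del: o_apply)
qed

end

section \<open>The diagonal and the description of \<open>FD n z\<close>\<close>

lemma word_perm_diag_full:
  assumes "\<And>e. 1 \<le> e \<Longrightarrow> e \<le> d \<Longrightarrow> (e, e) \<in> D"
  shows "word_perm (rev (diag_word D d)) = theta (2 * d)"
  using assms
proof (induction d)
  case 0
  then show ?case
    by (auto simp: diag_word_def theta_def fun_eq_iff)
next
  case (Suc d)
  then have "word_perm (rev (diag_word D (Suc d))) = adj (2 * d + 1) \<circ> theta (2 * d)"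
    by (simp add: diag_word_Suc del: o_apply)
  also have "\<dots> = theta (2 * Suc d)"
  proof
    fix x
    consider "x = 0" | "x \<in> {1..2 * d}" | "x = 2 * d + 1" | "x = 2 * d + 2" | "2 * d + 2 < x"
      by fastforce
    then show "(adj (2 * d + 1) \<circ> theta (2 * d)) x = theta (2 * Suc d) x"
    proof cases
      case 2
      have "theta (2 * d) x \<le> 2 * d"
        using theta_in[of "2 * d" x] 2 by simp
      then show ?thesis
        using 2 by (simp add: transpose_def) (simp add: theta_def)
    qed (auto simp: theta_def transpose_def)
  qed
  finally show ?case .
qed

text \<open>\<open>2 * d - 1\<close> is the only odd letter that moves \<open>2 * d\<close>, so a
  missing diagonal cell leaves a fixed point.\<close>

lemma word_perm_diag_fixed:
  assumes "(d, d) \<notin> D" "1 \<le> d"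
  shows "word_perm (rev (diag_word D m)) (2 * d) = 2 * d"
proof (induction m)
  case 0
  then show ?case
    by (simp add: diag_word_def)
next
  case (Suc m)
  show ?case
  proof (cases "(Suc m, Suc m) \<in> D")
    case True
    then have "d \<noteq> Suc m"
      using assms(1) by auto
    then have "2 * d \<noteq> 2 * m + 1" "2 * d \<noteq> Suc (2 * m + 1)"
      by presburger+
    then show ?thesis
      using Suc by (simp add: diag_word_Suc transpose_def)
  qed (use Suc in \<open>simp add: diag_word_Suc\<close>)
qed

lemma card_symmetric_dream:
  assumes E: "E \<subseteq> strict_lower n"
  shows "card (E \<union> E\<inverse> \<union> {(d, d) | d. 1 \<le> d \<and> 2 * d \<le> n}) = 2 * card E + n div 2"
proof -
  let ?A = "{(d, d) | d. 1 \<le> d \<and> 2 * d \<le> n}"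
  have fin: "finite E"
    using E by (rule finite_subset) simp
  have less: "c < r" if "(r, c) \<in> E" for r c
    using E that by (auto simp: strict_lower_def)
  have A: "?A = (\<lambda>d. (d, d)) ` {1..n div 2}"
    by (auto simp: image_iff)
  have "card ?A = n div 2"
    unfolding A by (subst card_image) (auto simp: inj_on_def)
  moreover have "E \<inter> E\<inverse> = {}" "(E \<union> E\<inverse>) \<inter> ?A = {}"
    by (auto dest!: less)
  moreover have "finite ?A"
    unfolding A by simp
  ultimately show ?thesis
    using fin by (simp add: card_Un_disjoint)
qed

text \<open>A missing diagonal cell would give \<open>z\<close> a fixed point, so a symmetric pipe
  dream for \<open>z\<close> contains the whole diagonal and is determined by its lower half. For
  such sets \<open>PD_iff_swept\<close> becomes the criterion \<open>fpf_dream\<close>.\<close>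

lemma FD_eq_fpf_dreams:
  assumes n: "even n" and z: "z \<in> fpf_involutions n"
  shows "FD n z = {E. fpf_dream n z E}"
proof -
  have perm: "z permutes {1..n}" and fpf: "\<And>i. i \<in> {1..n} \<Longrightarrow> z i \<noteq> i"
    using z by (auto simp: fpf_involutions_def)
  let ?tri = "{(i, j). i \<in> {1..n} \<and> j \<in> {1..n} \<and> i + j \<le> n}"
  have PD_iff: "D \<in> PD n z \<longleftrightarrow> fpf_dream n z (D \<inter> strict_lower n)"
    if sub: "D \<subseteq> ?tri" and sym: "sym D" and diag: "\<And>d. 1 \<le> d \<Longrightarrow> 2 * d \<le> n \<Longrightarrow> (d, d) \<in> D" for D
  proof -
    let ?E = "D \<inter> strict_lower n"
    define W where "W = dream_perm n ?E"
    have E: "?E \<subseteq> strict_lower n" "\<forall>(i, j)\<in>?E. i + j \<le> n"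
      using sub by auto
    have W: "W permutes {1..n}"
      unfolding W_def by (rule dream_perm_permutes[OF E])
    have "word_perm (rev (diag_word D (n div 2))) = theta n"
      using word_perm_diag_full[of "n div 2" D] diag n by simp
    then have "swept n D (triangle n) (W \<circ> (theta n \<circ> inv W))"
      using swept_symmetric[OF n sub sym] by (simp add: W_def)
    then have "D \<in> PD n z \<longleftrightarrow> z = W \<circ> (theta n \<circ> inv W) \<and> card D = card (inversions n z)"
      by (rule PD_iff_swept[OF sub perm])
    also have "z = W \<circ> (theta n \<circ> inv W) \<longleftrightarrow> z \<circ> W = W \<circ> theta n"
    proof
      assume "z = W \<circ> (theta n \<circ> inv W)"
      then have "z \<circ> W = W \<circ> (theta n \<circ> inv W) \<circ> W"
        by (rule arg_cong)
      then show "z \<circ> W = W \<circ> theta n"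
        by (simp only: comp_assoc permutes_inv_o(2)[OF W] comp_id)
    next
      assume "z \<circ> W = W \<circ> theta n"
      then have "z \<circ> W \<circ> inv W = W \<circ> theta n \<circ> inv W"
        by (rule arg_cong)
      then show "z = W \<circ> (theta n \<circ> inv W)"
        by (simp only: comp_assoc permutes_inv_o(1)[OF W] comp_id)
    qed
    also have "card D = 2 * card ?E + n div 2"
    proof -
      have "D = ?E \<union> ?E\<inverse> \<union> {(d, d) | d. 1 \<le> d \<and> 2 * d \<le> n}"
      proof (intro equalityI subsetI)
        fix x assume x: "x \<in> D"
        obtain i j where ij: "x = (i, j)"
          by (cases x)
        have "(j, i) \<in> D"
          using x sym ij by (auto dest: symD)
        then show "x \<in> ?E \<union> ?E\<inverse> \<union> {(d, d) | d. 1 \<le> d \<and> 2 * d \<le> n}"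
          using x sub unfolding ij by (cases i j rule: linorder_cases) (auto simp: strict_lower_def)
      qed (use sym diag in \<open>auto dest: symD\<close>)
      then show ?thesis
        using card_symmetric_dream[OF E(1)] by simp
    qed
    finally show ?thesis
      using E unfolding fpf_dream_def W_def[symmetric] by (auto simp del: o_apply)
  qed
  show ?thesis
  proof (intro equalityI subsetI)
    fix E assume "E \<in> FD n z"
    then obtain D where D: "D \<in> PD n z" "sym D" "E = D \<inter> strict_lower n"
      by (auto simp: FD_def)
    have sub: "D \<subseteq> ?tri"
      using D(1) by (simp add: PD_def reduced_pipe_dream_def)
    have "(d, d) \<in> D" if d: "1 \<le> d" "2 * d \<le> n" for d
    proof (rule ccontr)
      assume nd: "(d, d) \<notin> D"
      define W where "W = dream_perm n E"
      have W: "W permutes {1..n}"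
        unfolding W_def D(3) by (rule dream_perm_permutes) (use sub in auto)
      have "swept n D (triangle n) (W \<circ> (word_perm (rev (diag_word D (n div 2))) \<circ> inv W))"
        using swept_symmetric[OF n sub D(2)] by (simp only: W_def D(3))
      then have "z = W \<circ> (word_perm (rev (diag_word D (n div 2))) \<circ> inv W)"
        using PD_iff_swept[OF sub perm] D(1) by blast
      then have "z (W (2 * d)) = W (2 * d)"
        using word_perm_diag_fixed[OF nd d(1)] permutes_inverses(2)[OF W] by simp
      moreover have "W (2 * d) \<in> {1..n}"
        unfolding permutes_in_image[OF W] using d by simp
      ultimately show False
        using fpf by blast
    qed
    then show "E \<in> {E. fpf_dream n z E}"
      using PD_iff[OF sub D(2)] D(1,3) by simp
  next
    fix E assume "E \<in> {E. fpf_dream n z E}"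
    then have E: "E \<subseteq> strict_lower n" "\<And>i j. (i, j) \<in> E \<Longrightarrow> i + j \<le> n" "fpf_dream n z E"
      by (auto simp: fpf_dream_def)
    define D where "D = E \<union> E\<inverse> \<union> {(d, d) | d. 1 \<le> d \<and> 2 * d \<le> n}"
    have sub: "D \<subseteq> ?tri"
      using E(1,2) by (fastforce simp: D_def strict_lower_def)
    have sym: "sym D"
      by (auto simp: D_def sym_def)
    have "D \<inter> strict_lower n = E"
      using E(1) by (auto simp: D_def strict_lower_def)
    moreover from this have "D \<in> PD n z"
      using PD_iff[OF sub sym] E(3) by (auto simp: D_def)
    ultimately show "E \<in> FD n z"
      using sym by (auto simp: FD_def)
  qed
qed

theorem theorem5p14:
  fixes n :: nat and z :: "nat \<Rightarrow> nat"
  assumes "0 < n" and "even n" and "z \<in> fpf_involutions n"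
  shows "FD n z = {E. E \<subseteq> strict_lower n \<and> le_FD (fpf_bottom n z) E} \<and>
    {E. E \<subseteq> strict_lower n \<and> le_FD (fpf_bottom n z) E} =
      {E. E \<subseteq> strict_lower n \<and> sim_FD (fpf_bottom n z) E}"
proof -
  note n = assms(2)
  have bottom: "fpf_dream n z (fpf_bottom n z)"
    by (rule fpf_dream_fpf_bottom[OF assms(2,3)])
  have up: "E \<subseteq> strict_lower n \<and> le_FD (fpf_bottom n z) E \<longleftrightarrow> fpf_dream n z E" for E
  proof
    assume "E \<subseteq> strict_lower n \<and> le_FD (fpf_bottom n z) E"
    then show "fpf_dream n z E"
      using fpf_dream_ladder_chain_up[OF n bottom] unfolding le_FD_rtranclp by blast
  next
    assume "fpf_dream n z E"
    then show "E \<subseteq> strict_lower n \<and> le_FD (fpf_bottom n z) E"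
      using fpf_dream_bottom_le[OF n] unfolding le_FD_rtranclp fpf_dream_def by blast
  qed
  \<comment> \<open>The symmetric closure admits also the sets \<open>E\<close> from which a chain
    leads to the bottom element; these satisfy the criterion as well.\<close>
  have down: "fpf_dream n z E" if "E \<subseteq> strict_lower n" "le_FD E (fpf_bottom n z)" for E
    using fpf_dream_ladder_chain_down[OF n bottom] that by (simp add: le_FD_rtranclp)
  have "E \<subseteq> strict_lower n \<and> sim_FD (fpf_bottom n z) E \<longleftrightarrow> fpf_dream n z E" for E
    using up[of E] down[of E] by (auto simp: sim_FD_def symclp_def)
  then show ?thesis
    using up FD_eq_fpf_dreams[OF assms(2,3)] by simp
qed

end
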